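(* Let $(H,\rhd,\Phi)$ be a twisted post-Hopf algebra with sub-adjacent operation $\circ$. Then $(\Phi(H),\circ,\Delta,1,\epsilon)$ is a unital cocommutative bialgebra. Moreover, define $S_{\rhd}:\Phi(H)\to\Phi(H)$ by $$S_{\rhd}(\Phi(x))=T^{\rhd}_{\Phi(x_1)}(S(\Phi(x_2))),\quad\forall x\in H.$$ Then $(\Phi(H),\circ,\Delta,1,\epsilon,S_{\rhd})$ is a cocommutative Hopf algebra.
   Context: Base field $\mathbb F$ of characteristic zero; Sweedler notation $\Delta(x)=x_1\otimes x_2$. A weak twisted post-Hopf algebra $(H,\rhd,\Phi)$ is a cocommutative Hopf algebra $(H,\cdot,1,\Delta,\epsilon,S)$ with coalgebra morphisms $\rhd:H\otimes H\to H$ and $\Phi:H\to H$ such that, setting $x\circ y=\Phi(x_1)\cdot(x_2\rhd y)$ (the sub-adjacent operation), for all $x,y,z\in H$: $x\rhd(y\cdot z)=(x_1\rhd y)\cdot(x_2\rhd z)$; $(x\circ y)\rhd z=x\rhd(y\rhd z)$; $\Phi(x\circ y)=x\circ\Phi(y)$. It is a twisted post-Hopf algebra if moreover $\Phi(1)=1$ and the map $L^{\rhd}:H\to\mathrm{End}(H)$, $L^{\rhd}_x(y)=x\rhd y$, is convolution invertible in $\mathrm{Hom}(H,\mathrm{End}(H))$, i.e. there is a unique linear map $T^{\rhd}:H\to\mathrm{End}(H)$ such that, with juxtaposition denoting composition of endomorphisms, $L^{\rhd}_{x_1}T^{\rhd}_{x_2}=T^{\rhd}_{x_1}L^{\rhd}_{x_2}=\epsilon(x)\,\mathrm{id}_H$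 for all $x\in H$. *)

theory Defs
  imports Complex_Main "HOL-Library.Function_Algebras"
begin

section \<open>Multilinear preliminaries\<close>

definition linear_on ::
  "('k \<Rightarrow> 'v \<Rightarrow> 'v) \<Rightarrow> ('k \<Rightarrow> 'w \<Rightarrow> 'w) \<Rightarrow> 'v set \<Rightarrow> ('v::plus \<Rightarrow> 'w::plus) \<Rightarrow> bool" where
  "linear_on s1 s2 A f \<longleftrightarrow>
     (\<forall>x\<in>A. \<forall>y\<in>A. f (x + y) = f x + f y) \<and> (\<forall>c. \<forall>x\<in>A. f (s1 c x) = s2 c (f x))"

definition bilinear_on ::
  "('k \<Rightarrow> 'v \<Rightarrow> 'v) \<Rightarrow> ('k \<Rightarrow> 'w \<Rightarrow> 'w) \<Rightarrow> ('k \<Rightarrow> 'u \<Rightarrow> 'u) \<Rightarrow> 'v set \<Rightarrow> 'w set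
     \<Rightarrow> ('v::plus \<Rightarrow> 'w::plus \<Rightarrow> 'u::plus) \<Rightarrow> bool" where
  "bilinear_on s1 s2 s3 A B f \<longleftrightarrow>
     (\<forall>y\<in>B. linear_on s1 s3 A (\<lambda>x. f x y)) \<and> (\<forall>x\<in>A. linear_on s2 s3 B (f x))"

text \<open>Pointwise scalar multiplication on a space of functions. It is used for endomorphisms
  and for tensors; addition of functions is the pointwise one of \<^theory>\<open>HOL-Library.Function_Algebras\<close>.\<close>

definition fun_scale :: "('k \<Rightarrow> 'v \<Rightarrow> 'v) \<Rightarrow> 'k \<Rightarrow> ('i \<Rightarrow> 'v) \<Rightarrow> ('i \<Rightarrow> 'v)" where
  "fun_scale s c f = (\<lambda>i. s c (f i))"

section \<open>Tensor products\<close>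

text \<open>The tensor product of two vector spaces over a field \<open>k\<close> embeds into the dual of the space of
  bilinear forms, \<open>x \<otimes> y\<close> being evaluation at \<open>(x, y)\<close>. It is realised here as the span of these
  evaluations. Evaluations are set to 0 on functions that are not bilinear, so that the ambient
  space is a type.

  For subspaces \<open>A\<close>, \<open>B\<close> the canonical map from \<open>A \<otimes> B\<close> to the tensor product of the ambient spaces
  is injective (\<open>k\<close> is a field); \<open>A \<otimes> A\<close> is identified with its image \<open>tensor_space s A\<close>.\<close>

type_synonym ('v, 'w, 'k) tensor = "('v \<Rightarrow> 'w \<Rightarrow> 'k) \<Rightarrow> 'k"

definition pure_tensor ::
  "('k \<Rightarrow> 'v \<Rightarrow> 'v) \<Rightarrow> ('k \<Rightarrow> 'w \<Rightarrow> 'w) \<Rightarrow> 'v::ab_group_add \<Rightarrow> 'w::ab_group_add \<Rightarrow> ('v, 'w, 'k::field) tensor"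
  where
  "pure_tensor s1 s2 x y = (\<lambda>b. if bilinear_on s1 s2 (*) UNIV UNIV b then b x y else 0)"

abbreviation tensor_scale :: "'k::field \<Rightarrow> ('v, 'w, 'k) tensor \<Rightarrow> ('v, 'w, 'k) tensor" where
  "tensor_scale \<equiv> fun_scale (*)"

definition tensor_space ::
  "('k \<Rightarrow> 'v \<Rightarrow> 'v) \<Rightarrow> 'v::ab_group_add set \<Rightarrow> ('v, 'v, 'k::field) tensor set" where
  "tensor_space s A = module.span tensor_scale {pure_tensor s s x y | x y. x \<in> A \<and> y \<in> A}"

text \<open>\<open>tensor_lift s A f\<close> is the linear map on \<open>A \<otimes> A\<close> induced by a map \<open>f\<close> that is bilinear on
  \<open>A \<times> A\<close>: it sends a sum of tensors \<open>x \<otimes> y\<close> to the corresponding sum of values \<open>f x y\<close>. The lemmas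
  \<open>tensor_space_eq_sums\<close> and \<open>tensor_lift_eq\<close> below show that this is well defined.
  Sweedler notation reads \<open>f(x\<^sub>1, x\<^sub>2) = tensor_lift s A f (\<Delta> x)\<close>.\<close>

definition tensor_lift ::
  "('k \<Rightarrow> 'v \<Rightarrow> 'v) \<Rightarrow> 'v set \<Rightarrow> ('v \<Rightarrow> 'v \<Rightarrow> 'u) \<Rightarrow> ('v::ab_group_add, 'v, 'k::field) tensor
     \<Rightarrow> 'u::ab_group_add" where
  "tensor_lift s A f t =
     (THE u. \<exists>ps. set ps \<subseteq> A \<times> A \<and> t = (\<Sum>(x, y)\<leftarrow>ps. pure_tensor s s x y)
                \<and> u = (\<Sum>(x, y)\<leftarrow>ps. f x y))"

lemma vector_space_fun_scale:
  assumes "vector_space s"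
  shows "vector_space (fun_scale s)"
proof -
  interpret vector_space s by fact
  show ?thesis
    by unfold_locales (auto simp: fun_scale_def fun_eq_iff scale_right_distrib scale_left_distrib)
qed

lemma vector_space_mult: "vector_space ((*) :: 'k::field \<Rightarrow> 'k \<Rightarrow> 'k)"
  by unfold_locales (auto simp: algebra_simps)

lemma bilinear_on_pure_tensor:
  "bilinear_on s1 s2 tensor_scale UNIV UNIV (pure_tensor s1 s2)"
  by (auto simp: bilinear_on_def linear_on_def pure_tensor_def fun_scale_def fun_eq_iff)

lemma tensor_space_eq_sums:
  fixes s :: "'k::field \<Rightarrow> 'v::ab_group_add \<Rightarrow> 'v"
  assumes "vector_space s" "module.subspace s A"
  shows "tensor_space s A = {\<Sum>(x, y)\<leftarrow>ps. pure_tensor s s x y | ps. set ps \<subseteq> A \<times> A}"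
    (is "_ = ?R")
proof -
  interpret vector_space s by fact
  interpret t: vector_space "tensor_scale :: 'k \<Rightarrow> ('v, 'v, 'k) tensor \<Rightarrow> _"
    by (rule vector_space_fun_scale[OF vector_space_mult])
  have smult: "tensor_scale c (\<Sum>(x, y)\<leftarrow>ps. pure_tensor s s x y)
      = (\<Sum>(x, y)\<leftarrow>map (\<lambda>(x, y). (s c x, y)) ps. pure_tensor s s x y)" for c ps
  proof (induction ps)
    case Nil
    then show ?case by (simp add: fun_scale_def fun_eq_iff)
  next
    case (Cons p ps)
    obtain x y where "p = (x, y)" by (cases p)
    moreover have "tensor_scale c (pure_tensor s s x y) = pure_tensor s s (s c x) y"
      using bilinear_on_pure_tensor[of s s] by (auto simp: bilinear_on_def linear_on_def)
    ultimately show ?case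
      using Cons by (simp only: list.map sum_list.Cons prod.case t.scale_right_distrib)
  qed
  have "t.subspace ?R"
  proof (rule t.subspaceI)
    show "0 \<in> ?R" by (auto intro!: exI[of _ "[]"])
  next
    fix t u assume "t \<in> ?R" "u \<in> ?R"
    then obtain ps qs where "t = (\<Sum>(x, y)\<leftarrow>ps. pure_tensor s s x y)" "set ps \<subseteq> A \<times> A"
      "u = (\<Sum>(x, y)\<leftarrow>qs. pure_tensor s s x y)" "set qs \<subseteq> A \<times> A" by blast
    then show "t + u \<in> ?R" by (auto intro!: exI[of _ "ps @ qs"])
  next
    fix c t assume "t \<in> ?R"
    then obtain ps where ps: "t = (\<Sum>(x, y)\<leftarrow>ps. pure_tensor s s x y)" "set ps \<subseteq> A \<times> A" by blast
    from ps(2) have "set (map (\<lambda>(x, y). (s c x, y)) ps) \<subseteq> A \<times> A"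
      using subspace_scale[OF assms(2)] by fastforce
    moreover have "tensor_scale c t
        = (\<Sum>(x, y)\<leftarrow>map (\<lambda>(x, y). (s c x, y)) ps. pure_tensor s s x y)"
      unfolding ps(1) by (rule smult)
    ultimately show "tensor_scale c t \<in> ?R" by blast
  qed
  moreover have "{pure_tensor s s x y | x y. x \<in> A \<and> y \<in> A} \<subseteq> ?R"
  proof
    fix t assume "t \<in> {pure_tensor s s x y | x y. x \<in> A \<and> y \<in> A}"
    then obtain x y where "t = pure_tensor s s x y" "x \<in> A" "y \<in> A" by blast
    then show "t \<in> ?R" by (auto intro!: exI[of _ "[(x, y)]"])
  qed
  ultimately have "tensor_space s A \<subseteq> ?R"
    unfolding tensor_space_def by (intro t.span_minimal)
  moreover have "(\<Sum>(x, y)\<leftarrow>ps. pure_tensor s s x y) \<in> tensor_space s A"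
    if "set ps \<subseteq> A \<times> A" for ps
    using that
  proof (induction ps)
    case Nil
    then show ?case by (simp only: tensor_space_def t.span_zero list.map sum_list.Nil)
  next
    case (Cons p ps)
    obtain x y where p: "p = (x, y)" by (cases p)
    with Cons.prems have "pure_tensor s s x y \<in> tensor_space s A"
      unfolding tensor_space_def by (intro t.span_base) auto
    then show ?case
      using Cons p by (auto simp only: tensor_space_def list.map sum_list.Cons prod.case
          list.set insert_subset intro!: t.span_add)
  qed
  ultimately show ?thesis by blast
qed

lemma tensor_lift_eq:
  fixes s :: "'k::field \<Rightarrow> 'v::ab_group_add \<Rightarrow> 'v" and s' :: "'k \<Rightarrow> 'u::ab_group_add \<Rightarrow> 'u"
  assumes "vector_space s" "vector_space s'" "module.subspace s A"
    and f: "bilinear_on s s s' A A f" and ps: "set ps \<subseteq> A \<times> A"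
  shows "tensor_lift s A f (\<Sum>(x, y)\<leftarrow>ps. pure_tensor s s x y) = (\<Sum>(x, y)\<leftarrow>ps. f x y)"
proof -
  interpret vs: vector_space_pair s s using assms by (simp add: vector_space_pair_def)
  interpret vt: vector_space_pair s' "(*) :: 'k \<Rightarrow> 'k \<Rightarrow> 'k"
    using assms vector_space_mult by (simp add: vector_space_pair_def)
  have "Vector_Spaces.linear s s (\<lambda>x. x)" by (simp add: vs.vs1.linear_ident)
  then obtain p where p: "p ` UNIV \<subseteq> A" "Vector_Spaces.linear s s p" "\<forall>v\<in>A. p v = v"
    using vs.linear_exists_left_inverse_on[of "\<lambda>x. x" A] assms(3) by (auto simp: inj_on_def)
  interpret p: Vector_Spaces.linear s s p by fact
  have uniq: "(\<Sum>(x, y)\<leftarrow>qs. f x y) = (\<Sum>(x, y)\<leftarrow>ps. f x y)"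
    if qs: "set qs \<subseteq> A \<times> A"
      and eq: "(\<Sum>(x, y)\<leftarrow>ps. pure_tensor s s x y) = (\<Sum>(x, y)\<leftarrow>qs. pure_tensor s s x y)" for qs
  proof (rule ccontr)
    define u where "u = (\<Sum>(x, y)\<leftarrow>qs. f x y) - (\<Sum>(x, y)\<leftarrow>ps. f x y)"
    assume "\<not> ?thesis"
    then have "u \<noteq> 0" by (simp add: u_def)
    then have "vt.vs1.independent {u}" by (simp add: vt.vs1.dependent_single)
    from vt.linear_independent_extend[OF this, of "\<lambda>_. 1"]
    obtain g where g: "Vector_Spaces.linear s' (*) g" "g u = 1" by auto
    interpret g: Vector_Spaces.linear s' "(*)" g by fact
    define b where "b = (\<lambda>x y. g (f (p x) (p y)))"
    have b: "bilinear_on s s (*) UNIV UNIV b"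
      using f p(1) unfolding bilinear_on_def linear_on_def b_def
      by (auto simp: p.add p.scale g.add g.scale image_subset_iff)
    have ev: "(\<Sum>(x, y)\<leftarrow>rs. pure_tensor s s x y) b = g (\<Sum>(x, y)\<leftarrow>rs. f x y)"
      if "set rs \<subseteq> A \<times> A" for rs
      using that
    proof (induction rs)
      case Nil
      then show ?case by (simp add: g.zero)
    next
      case (Cons r rs)
      then show ?case using p(3) b by (cases r) (auto simp: g.add pure_tensor_def b_def)
    qed
    have "g u = 0" using ev[OF ps] ev[OF qs] eq by (simp add: u_def g.diff)
    with g(2) show False by simp
  qed
  show ?thesis
    unfolding tensor_lift_def using ps uniq by (intro the_equality) blast+
qed

section \<open>Hopf algebras carried by a subspace\<close>

text \<open>All structures below live on a subspace \<open>A\<close> of a vector space, and the operations matter only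
  on \<open>A\<close>; \<open>A = UNIV\<close> gives the structure on a whole vector space.\<close>

locale unital_algebra_on = vector_space scale
  for scale :: "'k::field_char_0 \<Rightarrow> 'h::ab_group_add \<Rightarrow> 'h" (infixr \<open>*s\<close> 75) +
  fixes A :: "'h set"
    and mult :: "'h \<Rightarrow> 'h \<Rightarrow> 'h" (infixl \<open>\<bullet>\<close> 70)
    and one :: 'h (\<open>\<one>\<close>)
  assumes carrier_subspace: "subspace A"
    and mult_closed: "x \<in> A \<Longrightarrow> y \<in> A \<Longrightarrow> x \<bullet> y \<in> A"
    and mult_bilinear: "bilinear_on scale scale scale A A mult"
    and mult_assoc: "x \<in> A \<Longrightarrow> y \<in> A \<Longrightarrow> z \<in> A \<Longrightarrow> (x \<bullet> y) \<bullet> z = x \<bullet> (y \<bullet> z)"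
    and one_closed: "\<one> \<in> A"
    and one_left: "x \<in> A \<Longrightarrow> \<one> \<bullet> x = x"
    and one_right: "x \<in> A \<Longrightarrow> x \<bullet> \<one> = x"

text \<open>Coassociativity is stated in \<open>V \<otimes> (V \<otimes> V)\<close>, the associativity isomorphism being applied to
  \<open>(x\<^sub>1\<^sub>1 \<otimes> x\<^sub>1\<^sub>2) \<otimes> x\<^sub>2\<close>.\<close>

locale coalgebra_on = vector_space scale
  for scale :: "'k::field_char_0 \<Rightarrow> 'h::ab_group_add \<Rightarrow> 'h" (infixr \<open>*s\<close> 75) +
  fixes A :: "'h set"
    and comult :: "'h \<Rightarrow> ('h, 'h, 'k) tensor" (\<open>\<Delta>\<close>)
    and counit :: "'h \<Rightarrow> 'k" (\<open>\<epsilon>\<close>)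
  assumes carrier_subspace: "subspace A"
    and comult_closed: "x \<in> A \<Longrightarrow> \<Delta> x \<in> tensor_space scale A"
    and comult_linear: "linear_on scale tensor_scale A \<Delta>"
    and counit_linear: "linear_on scale (*) A \<epsilon>"
    and coassoc: "x \<in> A \<Longrightarrow>
      tensor_lift scale A
        (\<lambda>a b. tensor_lift scale A
           (\<lambda>a1 a2. pure_tensor scale tensor_scale a1 (pure_tensor scale scale a2 b)) (\<Delta> a)) (\<Delta> x)
      = tensor_lift scale A (\<lambda>a b. pure_tensor scale tensor_scale a (\<Delta> b)) (\<Delta> x)"
    and counit_left: "x \<in> A \<Longrightarrow> tensor_lift scale A (\<lambda>a b. \<epsilon> a *s b) (\<Delta> x) = x"
    and counit_right: "x \<in> A \<Longrightarrow> tensor_lift scale A (\<lambda>a b. \<epsilon> b *s a) (\<Delta> x) = x"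

locale cocommutative_bialgebra_on =
  unital_algebra_on scale A mult one + coalgebra_on scale A comult counit
  for scale :: "'k::field_char_0 \<Rightarrow> 'h::ab_group_add \<Rightarrow> 'h" (infixr \<open>*s\<close> 75)
    and A :: "'h set"
    and mult :: "'h \<Rightarrow> 'h \<Rightarrow> 'h" (infixl \<open>\<bullet>\<close> 70)
    and one :: 'h (\<open>\<one>\<close>)
    and comult :: "'h \<Rightarrow> ('h, 'h, 'k) tensor" (\<open>\<Delta>\<close>)
    and counit :: "'h \<Rightarrow> 'k" (\<open>\<epsilon>\<close>) +
  assumes comult_mult: "x \<in> A \<Longrightarrow> y \<in> A \<Longrightarrow>
      \<Delta> (x \<bullet> y) =
        tensor_lift scale A
          (\<lambda>x1 x2. tensor_lift scale A
             (\<lambda>y1 y2. pure_tensor scale scale (x1 \<bullet> y1) (x2 \<bullet> y2)) (\<Delta> y)) (\<Delta> x)"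
    and comult_one: "\<Delta> \<one> = pure_tensor scale scale \<one> \<one>"
    and counit_mult: "x \<in> A \<Longrightarrow> y \<in> A \<Longrightarrow> \<epsilon> (x \<bullet> y) = \<epsilon> x * \<epsilon> y"
    and counit_one: "\<epsilon> \<one> = 1"
    and cocommutative: "x \<in> A \<Longrightarrow>
      tensor_lift scale A (\<lambda>a b. pure_tensor scale scale b a) (\<Delta> x) = \<Delta> x"

locale cocommutative_hopf_algebra_on =
  cocommutative_bialgebra_on scale A mult one comult counit
  for scale :: "'k::field_char_0 \<Rightarrow> 'h::ab_group_add \<Rightarrow> 'h" (infixr \<open>*s\<close> 75)
    and A :: "'h set"
    and mult :: "'h \<Rightarrow> 'h \<Rightarrow> 'h" (infixl \<open>\<bullet>\<close> 70)
    and one :: 'h (\<open>\<one>\<close>)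
    and comult :: "'h \<Rightarrow> ('h, 'h, 'k) tensor" (\<open>\<Delta>\<close>)
    and counit :: "'h \<Rightarrow> 'k" (\<open>\<epsilon>\<close>) +
  fixes antipode :: "'h \<Rightarrow> 'h" (\<open>S\<close>)
  assumes antipode_closed: "x \<in> A \<Longrightarrow> S x \<in> A"
    and antipode_linear: "linear_on scale scale A S"
    and antipode_left: "x \<in> A \<Longrightarrow> tensor_lift scale A (\<lambda>a b. S a \<bullet> b) (\<Delta> x) = \<epsilon> x *s \<one>"
    and antipode_right: "x \<in> A \<Longrightarrow> tensor_lift scale A (\<lambda>a b. a \<bullet> S b) (\<Delta> x) = \<epsilon> x *s \<one>"

section \<open>Twisted post-Hopf algebras\<close>

definition sub_adjacent ::
  "('k::field \<Rightarrow> 'h::ab_group_add \<Rightarrow> 'h) \<Rightarrow> ('h \<Rightarrow> 'h \<Rightarrow> 'h) \<Rightarrow> ('h \<Rightarrow> ('h, 'h, 'k) tensor) \<Rightarrow> ('h \<Rightarrow> 'h \<Rightarrow> 'h)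
     \<Rightarrow> ('h \<Rightarrow> 'h) \<Rightarrow> 'h \<Rightarrow> 'h \<Rightarrow> 'h" where
  "sub_adjacent scale mult comult rhd \<Phi> x y =
     tensor_lift scale UNIV (\<lambda>x1 x2. mult (\<Phi> x1) (rhd x2 y)) (comult x)"

text \<open>\<open>\<rhd>\<close> is a curried map \<open>H \<otimes> H \<rightarrow> H\<close>; that it is a coalgebra morphism is spelled out on pure
  tensors, with \<open>\<Delta>(x \<otimes> y) = (x\<^sub>1 \<otimes> y\<^sub>1) \<otimes> (x\<^sub>2 \<otimes> y\<^sub>2)\<close> and \<open>\<epsilon>(x \<otimes> y) = \<epsilon>(x) \<epsilon>(y)\<close>.\<close>

locale weak_twisted_post_hopf_algebra =
  cocommutative_hopf_algebra_on scale UNIV mult one comult counit antipode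
  for scale :: "'k::field_char_0 \<Rightarrow> 'h::ab_group_add \<Rightarrow> 'h" (infixr \<open>*s\<close> 75)
    and mult :: "'h \<Rightarrow> 'h \<Rightarrow> 'h" (infixl \<open>\<bullet>\<close> 70)
    and one :: 'h (\<open>\<one>\<close>)
    and comult :: "'h \<Rightarrow> ('h, 'h, 'k) tensor" (\<open>\<Delta>\<close>)
    and counit :: "'h \<Rightarrow> 'k" (\<open>\<epsilon>\<close>)
    and antipode :: "'h \<Rightarrow> 'h" (\<open>S\<close>) +
  fixes rhd :: "'h \<Rightarrow> 'h \<Rightarrow> 'h" (infixr \<open>\<rhd>\<close> 72)
    and \<Phi> :: "'h \<Rightarrow> 'h"
  assumes rhd_bilinear: "bilinear_on scale scale scale UNIV UNIV rhd"
    and rhd_comult: "\<Delta> (x \<rhd> y) =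
        tensor_lift scale UNIV
          (\<lambda>x1 x2. tensor_lift scale UNIV
             (\<lambda>y1 y2. pure_tensor scale scale (x1 \<rhd> y1) (x2 \<rhd> y2)) (\<Delta> y)) (\<Delta> x)"
    and rhd_counit: "\<epsilon> (x \<rhd> y) = \<epsilon> x * \<epsilon> y"
    and Phi_linear: "linear_on scale scale UNIV \<Phi>"
    and Phi_comult: "\<Delta> (\<Phi> x) =
        tensor_lift scale UNIV (\<lambda>x1 x2. pure_tensor scale scale (\<Phi> x1) (\<Phi> x2)) (\<Delta> x)"
    and Phi_counit: "\<epsilon> (\<Phi> x) = \<epsilon> x"
    and rhd_mult: "x \<rhd> (y \<bullet> z) = tensor_lift scale UNIV (\<lambda>x1 x2. (x1 \<rhd> y) \<bullet> (x2 \<rhd> z)) (\<Delta> x)"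
    and rhd_rhd: "sub_adjacent scale mult comult rhd \<Phi> x y \<rhd> z = x \<rhd> (y \<rhd> z)"
    and Phi_sub_adjacent:
      "\<Phi> (sub_adjacent scale mult comult rhd \<Phi> x y) = sub_adjacent scale mult comult rhd \<Phi> x (\<Phi> y)"

text \<open>\<open>T\<close> is a linear map \<open>H \<rightarrow> End(H)\<close> inverse to \<open>L\<^sub>x = rhd x\<close> for convolution; \<open>scale (counit x)\<close> is
  the endomorphism \<open>\<epsilon>(x) id\<close>.\<close>

definition convolution_inverse ::
  "('k::field \<Rightarrow> 'h::ab_group_add \<Rightarrow> 'h) \<Rightarrow> ('h \<Rightarrow> ('h, 'h, 'k) tensor) \<Rightarrow> ('h \<Rightarrow> 'k) \<Rightarrow> ('h \<Rightarrow> 'h \<Rightarrow> 'h)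
     \<Rightarrow> ('h \<Rightarrow> 'h \<Rightarrow> 'h) \<Rightarrow> bool" where
  "convolution_inverse scale comult counit rhd T \<longleftrightarrow>
     (\<forall>x. linear_on scale scale UNIV (T x)) \<and>
     linear_on scale (fun_scale scale) UNIV T \<and>
     (\<forall>x. tensor_lift scale UNIV (\<lambda>x1 x2. rhd x1 \<circ> T x2) (comult x) = scale (counit x) \<and>
          tensor_lift scale UNIV (\<lambda>x1 x2. T x1 \<circ> rhd x2) (comult x) = scale (counit x))"

definition T_rhd ::
  "('k::field \<Rightarrow> 'h::ab_group_add \<Rightarrow> 'h) \<Rightarrow> ('h \<Rightarrow> ('h, 'h, 'k) tensor) \<Rightarrow> ('h \<Rightarrow> 'k) \<Rightarrow> ('h \<Rightarrow> 'h \<Rightarrow> 'h)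
     \<Rightarrow> ('h \<Rightarrow> 'h \<Rightarrow> 'h)" where
  "T_rhd scale comult counit rhd = (THE T. convolution_inverse scale comult counit rhd T)"

locale twisted_post_hopf_algebra =
  weak_twisted_post_hopf_algebra scale mult one comult counit antipode rhd \<Phi>
  for scale :: "'k::field_char_0 \<Rightarrow> 'h::ab_group_add \<Rightarrow> 'h" (infixr \<open>*s\<close> 75)
    and mult :: "'h \<Rightarrow> 'h \<Rightarrow> 'h" (infixl \<open>\<bullet>\<close> 70)
    and one :: 'h (\<open>\<one>\<close>)
    and comult :: "'h \<Rightarrow> ('h, 'h, 'k) tensor" (\<open>\<Delta>\<close>)
    and counit :: "'h \<Rightarrow> 'k" (\<open>\<epsilon>\<close>)
    and antipode :: "'h \<Rightarrow> 'h" (\<open>S\<close>)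
    and rhd :: "'h \<Rightarrow> 'h \<Rightarrow> 'h" (infixr \<open>\<rhd>\<close> 72)
    and \<Phi> :: "'h \<Rightarrow> 'h" +
  assumes Phi_one: "\<Phi> \<one> = \<one>"
    and convolution_invertible: "\<exists>!T. convolution_inverse scale comult counit rhd T"

text \<open>The defining equation of \<open>S\<^sub>\<rhd>\<close>, which determines it on \<open>\<Phi>(H)\<close> only.\<close>

definition is_S_rhd ::
  "('k::field \<Rightarrow> 'h::ab_group_add \<Rightarrow> 'h) \<Rightarrow> ('h \<Rightarrow> ('h, 'h, 'k) tensor) \<Rightarrow> ('h \<Rightarrow> 'k) \<Rightarrow> ('h \<Rightarrow> 'h) \<Rightarrow> ('h \<Rightarrow> 'h \<Rightarrow> 'h)
     \<Rightarrow> ('h \<Rightarrow> 'h) \<Rightarrow> ('h \<Rightarrow> 'h) \<Rightarrow> bool" where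
  "is_S_rhd scale comult counit antipode rhd \<Phi> Srhd \<longleftrightarrow>
     (\<forall>x. Srhd (\<Phi> x) =
        tensor_lift scale UNIV
          (\<lambda>x1 x2. T_rhd scale comult counit rhd (\<Phi> x1) (antipode (\<Phi> x2))) (comult x))"

end

theory Submission
  imports Defs
begin

text \<open>Write \<open>x \<odot> y = \<Phi>(x\<^sub>1) (x\<^sub>2 \<rhd> y)\<close> for the sub-adjacent product. The key observation is that \<open>\<odot>\<close>
  is already an associative coalgebra morphism on all of \<open>H\<close>, for which \<open>1\<close> is a left unit and right
  multiplication by \<open>1\<close> is \<open>\<Phi>\<close>. Given these facts, associativity in \<open>(x \<odot> 1) \<odot> 1 = x \<odot> (1 \<odot> 1)\<close> shows
  that \<open>\<Phi>\<close> is idempotent, so \<open>\<Phi>(H)\<close> is exactly the set of elements for which \<open>1\<close> is also a right unit.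
  It is closed under \<open>\<odot>\<close> because \<open>\<Phi>(x \<odot> y) = x \<odot> \<Phi>(y)\<close>, and it is a subcoalgebra because \<open>\<Phi>\<close> is a
  coalgebra morphism.

  The two unit facts need an argument. The map \<open>x \<mapsto> x \<rhd> 1\<close> is idempotent for convolution and, being
  a coalgebra morphism into a Hopf algebra, has the convolution inverse \<open>x \<mapsto> S(x \<rhd> 1)\<close>; so it is
  \<open>x \<mapsto> \<epsilon>(x) 1\<close> (\<open>rhd_one\<close>), which gives \<open>x \<odot> 1 = \<Phi>(x)\<close>. Consequently \<open>1 \<odot> 1 = 1\<close>, the operator
  \<open>L\<^sub>1\<close> is idempotent, and it is invertible with inverse \<open>T\<^sub>1\<close>; so it is the identity (\<open>one_rhd\<close>).

  For the antipode, a direct computation with \<open>R = S\<^sub>\<rhd> \<circ> \<Phi>\<close> gives \<open>x\<^sub>1 \<odot> R(x\<^sub>2) = \<epsilon>(x) 1\<close>. Everything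
  else follows from a cancellation law (\<open>convolution_circ_cancel\<close>): a linear map \<open>f\<close> is determined by
  \<open>x \<mapsto> x\<^sub>1 \<odot> f(x\<^sub>2)\<close>, since the factor \<open>\<Phi>(x\<^sub>1)\<close> can be removed with \<open>S\<close> and the operator
  \<open>L\<close> with \<open>T\<close>. Cancellation shows that \<open>R\<close> takes values in \<open>\<Phi>(H)\<close>, by comparing \<open>R\<close> with \<open>\<Phi> \<circ> R\<close>,
  and that \<open>R(x\<^sub>1) \<odot> \<Phi>(x\<^sub>2) = \<epsilon>(x) 1\<close>, by comparing the left side with \<open>x \<mapsto> \<epsilon>(x) 1\<close>.

  Computations in Sweedler notation are carried out with \<open>sweedler F x\<close>, the value
  \<open>F(x\<^sub>1, x\<^sub>2)\<close> read off from one chosen expression of \<open>\<Delta>(x)\<close> as a sum of pure tensors.\<close>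

section \<open>Linear maps and maps out of tensor products\<close>

lemma linear_onI:
  assumes "\<And>x y. f (x + y) = f x + f y" "\<And>c x. f (s1 c x) = s2 c (f x)"
  shows "linear_on s1 s2 UNIV f"
  using assms by (simp add: linear_on_def)

lemma linear_on_add: "linear_on s1 s2 UNIV f \<Longrightarrow> f (x + y) = f x + f y"
  by (simp add: linear_on_def)

lemma linear_on_scale: "linear_on s1 s2 UNIV f \<Longrightarrow> f (s1 c x) = s2 c (f x)"
  by (simp add: linear_on_def)

lemma linear_on_compose:
  "linear_on s2 s3 UNIV g \<Longrightarrow> linear_on s1 s2 UNIV f \<Longrightarrow> linear_on s1 s3 UNIV (\<lambda>x. g (f x))"
  by (simp add: linear_on_def)

lemma linear_imp_linear_on: "Vector_Spaces.linear s1 s2 f \<Longrightarrow> linear_on s1 s2 UNIV f"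
  by (rule linear_onI) (simp_all add: Vector_Spaces.linear.axioms module_hom.add module_hom.scale
      Vector_Spaces.linear_iff_module_hom)

lemma bilinear_onI:
  assumes "\<And>y. linear_on s1 s3 UNIV (\<lambda>x. f x y)" "\<And>x. linear_on s2 s3 UNIV (\<lambda>y. f x y)"
  shows "bilinear_on s1 s2 s3 UNIV UNIV f"
  using assms by (simp add: bilinear_on_def)

lemma bilinear_onD1: "bilinear_on s1 s2 s3 UNIV UNIV f \<Longrightarrow> linear_on s1 s3 UNIV (\<lambda>x. f x y)"
  by (simp add: bilinear_on_def)

lemma bilinear_onD2: "bilinear_on s1 s2 s3 UNIV UNIV f \<Longrightarrow> linear_on s2 s3 UNIV (\<lambda>y. f x y)"
  by (simp add: bilinear_on_def)

text \<open>Identities in an arbitrary target space can thus be tested after a linear functional. This is what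
  makes coassociativity, an identity between evaluations at scalar-valued bilinear forms, usable for
  vector-valued maps.\<close>

lemma linear_functionals_separate:
  fixes s :: "'k::field \<Rightarrow> 'u::ab_group_add \<Rightarrow> 'u"
  assumes "vector_space s" "\<And>g. linear_on s (*) UNIV g \<Longrightarrow> g u = g v"
  shows "u = v"
proof (rule ccontr)
  interpret vector_space_pair s "(*) :: 'k \<Rightarrow> 'k \<Rightarrow> 'k"
    using assms vector_space_mult by (simp add: vector_space_pair_def)
  assume "u \<noteq> v"
  then have "vs1.independent {u - v}" by (simp add: vs1.dependent_single)
  from linear_independent_extend[OF this, of "\<lambda>_. 1"]
  obtain g where g: "Vector_Spaces.linear s (*) g" "g (u - v) = 1" by auto
  then interpret g: Vector_Spaces.linear s "(*)" g by simp
  from assms(2)[OF linear_imp_linear_on[OF g(1)]] g(2) show False by (simp add: g.diff)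
qed

lemma linear_on_sum_list:
  fixes f :: "'v::ab_group_add \<Rightarrow> 'w::ab_group_add"
  assumes "linear_on s1 s2 UNIV f"
  shows "f (\<Sum>(x, y)\<leftarrow>ps. F x y) = (\<Sum>(x, y)\<leftarrow>ps. f (F x y))"
proof -
  have "f 0 = 0" using linear_on_add[OF assms, of 0 0] by simp
  then show ?thesis by (induction ps) (auto simp: linear_on_add[OF assms])
qed

lemma tensor_lift_linear:
  fixes s :: "'k::field \<Rightarrow> 'v::ab_group_add \<Rightarrow> 'v" and s' :: "'k \<Rightarrow> 'u::ab_group_add \<Rightarrow> 'u"
  assumes s: "vector_space s" and s': "vector_space s'"
    and F: "bilinear_on s s s' UNIV UNIV F"
  shows "linear_on tensor_scale s' (tensor_space s UNIV) (tensor_lift s UNIV F)"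
proof -
  interpret vector_space s by fact
  interpret s': vector_space s' by fact
  interpret t: vector_space "tensor_scale :: 'k \<Rightarrow> ('v, 'v, 'k) tensor \<Rightarrow> _"
    by (rule vector_space_fun_scale[OF vector_space_mult])
  have sub: "subspace UNIV" by simp
  note lift = tensor_lift_eq[OF s s' sub F, simplified]
  note lists = tensor_space_eq_sums[OF s sub, simplified]
  have scale_list: "r c (\<Sum>(x, y)\<leftarrow>ps. G x y) = (\<Sum>(x, y)\<leftarrow>map (\<lambda>(x, y). (s c x, y)) ps. G x y)"
    if "vector_space r" "bilinear_on s s r UNIV UNIV G"
    for r :: "'k \<Rightarrow> 'w::ab_group_add \<Rightarrow> 'w" and G c ps
  proof -
    interpret r: vector_space r by fact
    show ?thesis
      using that(2) by (induction ps) (auto simp: r.scale_right_distrib bilinear_on_def linear_on_def)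
  qed
  show ?thesis
    unfolding linear_on_def
  proof (intro conjI ballI allI)
    fix t u assume "t \<in> tensor_space s UNIV" "u \<in> tensor_space s UNIV"
    then obtain ps qs where "t = (\<Sum>(x, y)\<leftarrow>ps. pure_tensor s s x y)"
      "u = (\<Sum>(x, y)\<leftarrow>qs. pure_tensor s s x y)" unfolding lists by blast
    then have "t + u = (\<Sum>(x, y)\<leftarrow>ps @ qs. pure_tensor s s x y)" by simp
    then show "tensor_lift s UNIV F (t + u) = tensor_lift s UNIV F t + tensor_lift s UNIV F u"
      using \<open>t = _\<close> \<open>u = _\<close> by (simp only: lift) simp
  next
    fix c t assume "t \<in> tensor_space s UNIV"
    then obtain ps where t: "t = (\<Sum>(x, y)\<leftarrow>ps. pure_tensor s s x y)" unfolding lists by blast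
    show "tensor_lift s UNIV F (tensor_scale c t) = s' c (tensor_lift s UNIV F t)"
      unfolding t scale_list[OF t.vector_space_axioms bilinear_on_pure_tensor] lift
        scale_list[OF s' F] ..
  qed
qed

text \<open>The type of tensors is larger than the tensor product. Composing with a projection turns a linear
  map on the tensor product into one on the whole type, as needed for the bilinear forms at which
  tensors in \<open>V \<otimes> (V \<otimes> V)\<close> are evaluated.\<close>

lemma tensor_space_projection:
  fixes s :: "'k::field \<Rightarrow> 'v::ab_group_add \<Rightarrow> 'v"
  obtains P where "linear_on tensor_scale tensor_scale UNIV P"
    "\<And>t. P t \<in> tensor_space s UNIV" "\<And>t. t \<in> tensor_space s UNIV \<Longrightarrow> P t = t"
proof -
  have vs: "vector_space (tensor_scale :: 'k \<Rightarrow> ('v, 'v, 'k) tensor \<Rightarrow> _)"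
    by (rule vector_space_fun_scale[OF vector_space_mult])
  interpret vector_space_pair "tensor_scale :: 'k \<Rightarrow> ('v, 'v, 'k) tensor \<Rightarrow> _"
    "tensor_scale :: 'k \<Rightarrow> ('v, 'v, 'k) tensor \<Rightarrow> _"
    using vs by (simp add: vector_space_pair_def)
  have "Vector_Spaces.linear tensor_scale tensor_scale (\<lambda>t::('v, 'v, 'k) tensor. t)"
    by (simp add: vs1.linear_ident)
  moreover have "vs1.subspace (tensor_space s UNIV)"
    unfolding tensor_space_def by (rule vs1.subspace_span)
  ultimately obtain P where P: "P ` UNIV \<subseteq> tensor_space s UNIV"
    "Vector_Spaces.linear tensor_scale tensor_scale P" "\<forall>t\<in>tensor_space s UNIV. P t = t"
    using linear_exists_left_inverse_on[of "\<lambda>t. t" "tensor_space s UNIV"] by (auto simp: inj_on_def)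
  then show ?thesis by (intro that[of P] linear_imp_linear_on) auto
qed

lemma pure_tensor_in_tensor_space:
  fixes s :: "'k::field \<Rightarrow> 'v::ab_group_add \<Rightarrow> 'v"
  assumes "x \<in> A" "y \<in> A"
  shows "pure_tensor s s x y \<in> tensor_space s A"
proof -
  interpret t: vector_space "tensor_scale :: 'k \<Rightarrow> ('v, 'v, 'k) tensor \<Rightarrow> _"
    by (rule vector_space_fun_scale[OF vector_space_mult])
  show ?thesis unfolding tensor_space_def using assms by (intro t.span_base) auto
qed

lemma tensor_lift_pure:
  fixes s :: "'k::field \<Rightarrow> 'v::ab_group_add \<Rightarrow> 'v"
  assumes "vector_space s" "vector_space s'" "bilinear_on s s s' UNIV UNIV F"
  shows "tensor_lift s UNIV F (pure_tensor s s x y) = F x y"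
proof -
  interpret vector_space s by fact
  show ?thesis
    using tensor_lift_eq[OF assms(1,2) _ assms(3), of "[(x, y)]"] by simp
qed

text \<open>Identities on a subspace follow from the Sweedler calculus of the ambient space, even for a map \<open>f\<close>
  without any structure off the subspace: a bilinear \<open>F\<close> takes its place.\<close>

lemma tensor_lift_subspace:
  fixes s :: "'k::field \<Rightarrow> 'v::ab_group_add \<Rightarrow> 'v"
  assumes s: "vector_space s" and s': "vector_space s'" and A: "module.subspace s A"
    and F: "bilinear_on s s s' UNIV UNIV F" and f: "\<And>x y. x \<in> A \<Longrightarrow> y \<in> A \<Longrightarrow> f x y = F x y"
    and t: "t \<in> tensor_space s A"
  shows "tensor_lift s A f t = tensor_lift s UNIV F t"
proof -
  interpret vector_space s by fact
  obtain ps where ps: "set ps \<subseteq> A \<times> A" "t = (\<Sum>(x, y)\<leftarrow>ps. pure_tensor s s x y)"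
    using t unfolding tensor_space_eq_sums[OF s A] by blast
  have "bilinear_on s s s' A A f"
    using F subspace_add[OF A] subspace_scale[OF A] by (simp add: bilinear_on_def linear_on_def f)
  then have "tensor_lift s A f t = (\<Sum>(x, y)\<leftarrow>ps. f x y)"
    unfolding ps(2) by (rule tensor_lift_eq[OF s s' A _ ps(1)])
  also have "\<dots> = (\<Sum>(x, y)\<leftarrow>ps. F x y)"
    using ps(1) f by (intro arg_cong[of _ _ sum_list] map_cong) auto
  also have "\<dots> = tensor_lift s UNIV F t"
    unfolding ps(2) by (intro tensor_lift_eq[OF s s' _ F, symmetric]) auto
  finally show ?thesis .
qed

section \<open>Sweedler calculus\<close>

locale cocommutative_coalgebra = coalgebra_on scale UNIV comult counit
  for scale :: "'k::field_char_0 \<Rightarrow> 'h::ab_group_add \<Rightarrow> 'h" (infixr \<open>*s\<close> 75)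
    and comult :: "'h \<Rightarrow> ('h, 'h, 'k) tensor" (\<open>\<Delta>\<close>)
    and counit :: "'h \<Rightarrow> 'k" (\<open>\<epsilon>\<close>) +
  assumes cocomm: "tensor_lift scale UNIV (\<lambda>a b. pure_tensor scale scale b a) (\<Delta> x) = \<Delta> x"
begin

text \<open>A chosen expression of \<open>\<Delta>(x)\<close> as a sum of pure tensors. Fixing one makes \<open>sweedler\<close> a plain finite
  sum, so that linear maps can be moved inside it and two such sums can be exchanged without
  any bilinearity condition. Independence of the choice, for bilinear maps, is \<open>tensor_lift_comult\<close>.\<close>

definition comult_list :: "'h \<Rightarrow> ('h \<times> 'h) list" where
  "comult_list x = (SOME ps. \<Delta> x = (\<Sum>(a, b)\<leftarrow>ps. pure_tensor scale scale a b))"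

definition sweedler :: "('h \<Rightarrow> 'h \<Rightarrow> 'u::ab_group_add) \<Rightarrow> 'h \<Rightarrow> 'u" where
  "sweedler F x = (\<Sum>(a, b)\<leftarrow>comult_list x. F a b)"

lemma comult_eq_sweedler: "\<Delta> x = sweedler (pure_tensor scale scale) x"
proof -
  have "\<exists>ps. \<Delta> x = (\<Sum>(a, b)\<leftarrow>ps. pure_tensor scale scale a b)"
    using comult_closed[of x] tensor_space_eq_sums[OF vector_space_axioms carrier_subspace] by auto
  then show ?thesis unfolding sweedler_def comult_list_def by (rule someI_ex)
qed

lemma tensor_lift_comult:
  assumes "vector_space s'" "bilinear_on scale scale s' UNIV UNIV F"
  shows "tensor_lift scale UNIV F (\<Delta> x) = sweedler F x"
  by (subst comult_eq_sweedler, unfold sweedler_def)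
    (rule tensor_lift_eq[OF vector_space_axioms assms(1) carrier_subspace assms(2)], simp)

lemma linear_on_sweedler:
  assumes "linear_on s1 s2 UNIV g"
  shows "g (sweedler F x) = sweedler (\<lambda>a b. g (F a b)) x"
  unfolding sweedler_def by (rule linear_on_sum_list[OF assms])

lemma sweedler_exchange:
  "sweedler (\<lambda>a b. sweedler (\<lambda>c d. F a b c d) y) x = sweedler (\<lambda>c d. sweedler (\<lambda>a b. F a b c d) x) y"
proof -
  have "(\<Sum>(a, b)\<leftarrow>ps. \<Sum>(c, d)\<leftarrow>qs. F a b c d) = (\<Sum>(c, d)\<leftarrow>qs. \<Sum>(a, b)\<leftarrow>ps. F a b c d)" for ps qs
  proof (induction ps)
    case Nil
    then show ?case by (induction qs) auto
  next
    case (Cons p ps)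
    then show ?case by (cases p) (simp add: sum_list_addf[symmetric] case_prod_unfold)
  qed
  then show ?thesis by (simp add: sweedler_def)
qed

abbreviation lin :: "('k \<Rightarrow> 'u \<Rightarrow> 'u) \<Rightarrow> ('h \<Rightarrow> 'u::plus) \<Rightarrow> bool" where
  "lin s f \<equiv> linear_on scale s UNIV f"

text \<open>The following rules decide linearity of an expression in one of its variables by its syntax: in each
  of them the variable occurs in a single place of the head operation, so that backward chaining never
  has a choice.\<close>

lemma lin_ident: "lin scale (\<lambda>x. x)"
  by (rule linear_onI) auto

lemma lin_sweedler_fun:
  assumes s: "vector_space s" and F: "\<And>a b. lin s (\<lambda>x. F x a b)"
  shows "lin s (\<lambda>x. sweedler (F x) c)"
proof -
  interpret s: vector_space s by fact
  have "linear_on scale s UNIV (\<lambda>x. \<Sum>(a, b)\<leftarrow>ps. F x a b)" for ps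
    using F by (induction ps) (auto simp: linear_on_def s.scale_right_distrib algebra_simps)
  then show ?thesis by (simp add: sweedler_def)
qed

lemma lin_comult: "lin tensor_scale \<Delta>"
  by (rule comult_linear)

lemma lin_sweedler_arg:
  assumes s: "vector_space s" and F: "bilinear_on scale scale s UNIV UNIV F" and f: "lin scale f"
  shows "lin s (\<lambda>x. sweedler F (f x))"
proof -
  have "linear_on tensor_scale s (tensor_space scale UNIV) (tensor_lift scale UNIV F)"
    by (rule tensor_lift_linear[OF vector_space_axioms s F])
  then have "lin s (\<lambda>x. tensor_lift scale UNIV F (\<Delta> x))"
    using comult_closed lin_comult by (auto simp: linear_on_def)
  then show ?thesis
    unfolding tensor_lift_comult[OF s F] using f by (rule linear_on_compose)
qed

lemma lin_scale_left: "lin (*) f \<Longrightarrow> lin scale (\<lambda>x. f x *s v)"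
  by (simp add: linear_on_def scale_left_distrib)

lemma lin_scale_right: "lin scale f \<Longrightarrow> lin scale (\<lambda>x. c *s f x)"
  by (simp add: linear_on_def scale_right_distrib mult.commute)

lemma lin_counit: "lin scale f \<Longrightarrow> lin (*) (\<lambda>x. \<epsilon> (f x))"
  by (rule linear_on_compose[OF counit_linear])

lemma lin_pure_left: "lin scale f \<Longrightarrow> lin tensor_scale (\<lambda>x. pure_tensor scale s2 (f x) y)"
  using bilinear_on_pure_tensor[of scale s2] by (rule linear_on_compose[OF bilinear_onD1])

lemma lin_pure_right: "lin s2 f \<Longrightarrow> lin tensor_scale (\<lambda>x. pure_tensor scale s2 y (f x))"
  using bilinear_on_pure_tensor[of scale s2] by (rule linear_on_compose[OF bilinear_onD2])

lemmas vs_tensor = vector_space_fun_scale[OF vector_space_mult]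

lemmas lin_basics = bilinear_onI lin_ident lin_sweedler_fun lin_sweedler_arg vector_space_axioms
  vector_space_mult vs_tensor lin_scale_left lin_scale_right lin_counit lin_pure_left lin_pure_right

text \<open>An identity for \<open>\<Delta>\<close> becomes one for \<open>sweedler F\<close> by applying the linear map \<open>E\<close> induced by \<open>F\<close>;
  it is defined on the whole type so that the general rules for linear maps apply.\<close>

lemma comult_extension:
  assumes s: "vector_space s" and F: "bilinear_on scale scale s UNIV UNIV F"
  obtains E where "linear_on tensor_scale s UNIV E" "\<And>x y. E (pure_tensor scale scale x y) = F x y"
    "\<And>x. E (\<Delta> x) = sweedler F x"
proof -
  obtain P :: "('h, 'h, 'k) tensor \<Rightarrow> _"
    where P: "linear_on tensor_scale tensor_scale UNIV P"
      "\<And>t. P t \<in> tensor_space scale UNIV" "\<And>t. t \<in> tensor_space scale UNIV \<Longrightarrow> P t = t"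
    by (rule tensor_space_projection[of scale]) blast
  show ?thesis
  proof (rule that)
    show lin: "linear_on tensor_scale s UNIV (\<lambda>t. tensor_lift scale UNIV F (P t))"
      using P tensor_lift_linear[OF vector_space_axioms s F] by (auto simp: linear_on_def)
    show "tensor_lift scale UNIV F (P (pure_tensor scale scale x y)) = F x y" for x y
      by (simp add: P(3) pure_tensor_in_tensor_space tensor_lift_pure[OF vector_space_axioms s F])
    show "tensor_lift scale UNIV F (P (\<Delta> x)) = sweedler F x" for x
      by (simp add: P(3) comult_closed tensor_lift_comult[OF s F])
  qed
qed

text \<open>\<open>F(x\<^sub>1\<^sub>1, x\<^sub>1\<^sub>2, x\<^sub>2) = F(x\<^sub>1, x\<^sub>2\<^sub>1, x\<^sub>2\<^sub>2)\<close>. After composition of \<open>F\<close> with a functional \<open>g\<close>, both sides are the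
  values of the two sides of the coassociativity axiom at the bilinear form \<open>B(a, t)\<close> that extends
  \<open>B(a, b \<otimes> c) = g (F a b c)\<close>.\<close>

lemma sweedler_coassoc:
  fixes F :: "'h \<Rightarrow> 'h \<Rightarrow> 'h \<Rightarrow> 'u::ab_group_add"
  assumes s: "vector_space s"
    and F: "\<And>b c. lin s (\<lambda>a. F a b c)" "\<And>a c. lin s (\<lambda>b. F a b c)" "\<And>a b. lin s (\<lambda>c. F a b c)"
  shows "sweedler (\<lambda>a b. sweedler (\<lambda>c d. F c d b) a) x = sweedler (\<lambda>a b. sweedler (\<lambda>c d. F a c d) b) x"
proof (rule linear_functionals_separate[OF s])
  fix g assume g: "linear_on s (*) UNIV g"
  let ?pt = "pure_tensor scale scale" and ?pt' = "pure_tensor scale tensor_scale"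
  obtain P :: "('h, 'h, 'k) tensor \<Rightarrow> _"
    where P: "linear_on tensor_scale tensor_scale UNIV P"
      "\<And>t. P t \<in> tensor_space scale UNIV" "\<And>t. t \<in> tensor_space scale UNIV \<Longrightarrow> P t = t"
    by (rule tensor_space_projection[of scale]) blast
  have bil: "bilinear_on scale scale s UNIV UNIV (F a)" for a
    by (intro bilinear_onI F)
  define B where "B = (\<lambda>a t. g (tensor_lift scale UNIV (F a) (P t)))"
  have pure: "B a (?pt b c) = g (F a b c)" for a b c
    by (simp add: B_def P(3) pure_tensor_in_tensor_space tensor_lift_pure[OF vector_space_axioms s bil])
  have comult: "B a (\<Delta> b) = g (sweedler (\<lambda>c d. F a c d) b)" for a b
    by (simp add: B_def P(3) comult_closed tensor_lift_comult[OF s bil])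
  have "bilinear_on scale tensor_scale (*) UNIV UNIV B"
  proof (rule bilinear_onI)
    show "linear_on tensor_scale (*) UNIV (\<lambda>t. B a t)" for a
      unfolding B_def using g P tensor_lift_linear[OF vector_space_axioms s bil]
      by (auto simp: linear_on_def)
    have "lin s (\<lambda>a. tensor_lift scale UNIV (F a) t)" if t: "t \<in> tensor_space scale UNIV" for t
    proof -
      interpret s: vector_space s by fact
      obtain ps where ps: "t = (\<Sum>(x, y)\<leftarrow>ps. ?pt x y)"
        using t unfolding tensor_space_eq_sums[OF vector_space_axioms carrier_subspace] by blast
      have "lin s (\<lambda>a. \<Sum>(x, y)\<leftarrow>ps. F a x y)"
        using F(1) by (induction ps) (auto simp: linear_on_def s.scale_right_distrib algebra_simps)
      then show ?thesis
        unfolding ps by (subst tensor_lift_eq[OF vector_space_axioms s carrier_subspace bil]) auto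
    qed
    then show "lin (*) (\<lambda>a. B a t)" for t
      unfolding B_def using linear_on_compose[OF g] P(2) by blast
  qed
  then have eval: "?pt' a t B = B a t" for a t
    by (simp add: pure_tensor_def)
  have evB: "linear_on tensor_scale (*) UNIV (\<lambda>t::('h, ('h, 'h, 'k) tensor, 'k) tensor. t B)"
    by (rule linear_onI) (auto simp: fun_scale_def)
  have "sweedler (\<lambda>a b. sweedler (\<lambda>c d. ?pt' c (?pt d b)) a) x = sweedler (\<lambda>a b. ?pt' a (\<Delta> b)) x"
  proof -
    have "tensor_lift scale UNIV (\<lambda>a1 a2. ?pt' a1 (?pt a2 b)) (\<Delta> a)
        = sweedler (\<lambda>a1 a2. ?pt' a1 (?pt a2 b)) a" for a b
      by (intro tensor_lift_comult[OF vs_tensor] lin_basics)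
    moreover have "tensor_lift scale UNIV (\<lambda>a b. sweedler (\<lambda>c d. ?pt' c (?pt d b)) a) (\<Delta> x)
        = sweedler (\<lambda>a b. sweedler (\<lambda>c d. ?pt' c (?pt d b)) a) x"
      by (intro tensor_lift_comult[OF vs_tensor] lin_basics)
    moreover have "tensor_lift scale UNIV (\<lambda>a b. ?pt' a (\<Delta> b)) (\<Delta> x) = sweedler (\<lambda>a b. ?pt' a (\<Delta> b)) x"
      by (intro tensor_lift_comult[OF vs_tensor] lin_basics lin_comult)
    ultimately show ?thesis using coassoc[of x] by simp
  qed
  then have "sweedler (\<lambda>a b. sweedler (\<lambda>c d. ?pt' c (?pt d b)) a) x B
      = sweedler (\<lambda>a b. ?pt' a (\<Delta> b)) x B" by simp
  then show "g (sweedler (\<lambda>a b. sweedler (\<lambda>c d. F c d b) a) x)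
      = g (sweedler (\<lambda>a b. sweedler (\<lambda>c d. F a c d) b) x)"
    by (simp add: linear_on_sweedler[OF evB] eval pure comult linear_on_sweedler[OF g])
qed

lemma sweedler_cocomm:
  assumes s: "vector_space s" and F: "bilinear_on scale scale s UNIV UNIV F"
  shows "sweedler (\<lambda>a b. F b a) x = sweedler F x"
proof -
  obtain E where E: "linear_on tensor_scale s UNIV E"
    "\<And>x y. E (pure_tensor scale scale x y) = F x y" "\<And>x. E (\<Delta> x) = sweedler F x"
    by (rule comult_extension[OF s F]) blast
  have "\<Delta> x = sweedler (\<lambda>a b. pure_tensor scale scale b a) x"
    by (subst cocomm[symmetric]) (intro tensor_lift_comult[OF vs_tensor] lin_basics)
  then have "E (\<Delta> x) = sweedler (\<lambda>a b. F b a) x"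
    by (simp add: linear_on_sweedler[OF E(1)] E(2))
  then show ?thesis by (simp add: E(3))
qed

lemma sweedler_counit_left:
  assumes "lin s f"
  shows "sweedler (\<lambda>a b. s (\<epsilon> a) (f b)) x = f x"
proof -
  have "sweedler (\<lambda>a b. \<epsilon> a *s b) x = x"
    by (subst tensor_lift_comult[OF vector_space_axioms, symmetric])
      (intro counit_left lin_basics UNIV_I)+
  from arg_cong[OF this, of f] show ?thesis
    by (simp add: linear_on_sweedler[OF assms] linear_on_scale[OF assms])
qed

lemma sweedler_counit_right:
  assumes "lin s f"
  shows "sweedler (\<lambda>a b. s (\<epsilon> b) (f a)) x = f x"
proof -
  have "sweedler (\<lambda>a b. \<epsilon> b *s a) x = x"
    by (subst tensor_lift_comult[OF vector_space_axioms, symmetric])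
      (intro counit_right lin_basics UNIV_I)+
  from arg_cong[OF this, of f] show ?thesis
    by (simp add: linear_on_sweedler[OF assms] linear_on_scale[OF assms])
qed

text \<open>\<open>F(x\<^sub>1, x\<^sub>2, x\<^sub>3, x\<^sub>4) = F(x\<^sub>1, x\<^sub>3, x\<^sub>2, x\<^sub>4)\<close>: coassociativity isolates the two middle factors
  as the coproduct of one element, to which cocommutativity applies. This is where cocommutativity
  makes \<open>\<odot>\<close> a coalgebra morphism.\<close>

lemma sweedler_middle_swap:
  fixes F :: "'h \<Rightarrow> 'h \<Rightarrow> 'h \<Rightarrow> 'h \<Rightarrow> 'u::ab_group_add"
  assumes s: "vector_space s"
    and F: "\<And>b c d. lin s (\<lambda>a. F a b c d)" "\<And>a c d. lin s (\<lambda>b. F a b c d)"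
      "\<And>a b d. lin s (\<lambda>c. F a b c d)" "\<And>a b c. lin s (\<lambda>d. F a b c d)"
  shows "sweedler (\<lambda>a b. sweedler (\<lambda>a1 a2. sweedler (\<lambda>b1 b2. F a1 a2 b1 b2) b) a) x
       = sweedler (\<lambda>a b. sweedler (\<lambda>a1 a2. sweedler (\<lambda>b1 b2. F a1 b1 a2 b2) b) a) x"
proof -
  have "sweedler (\<lambda>c d. sweedler (\<lambda>p q. F a c p q) d) r = sweedler (\<lambda>c d. sweedler (\<lambda>p q. F a p c q) d) r"
    for a r
  proof -
    have "sweedler (\<lambda>c d. sweedler (\<lambda>p q. F a c p q) d) r = sweedler (\<lambda>e q. sweedler (\<lambda>c p. F a c p q) e) r"
      by (intro sweedler_coassoc[OF s, symmetric] F)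
    also have "\<dots> = sweedler (\<lambda>e q. sweedler (\<lambda>c p. F a p c q) e) r"
      by (subst sweedler_cocomm[OF s]) (intro bilinear_onI F refl)+
    also have "\<dots> = sweedler (\<lambda>c d. sweedler (\<lambda>p q. F a p c q) d) r"
      by (intro sweedler_coassoc[OF s] F)
    finally show ?thesis .
  qed
  moreover have "sweedler (\<lambda>a b. sweedler (\<lambda>a1 a2. sweedler (\<lambda>b1 b2. G a1 a2 b1 b2) b) a) x
      = sweedler (\<lambda>a r. sweedler (\<lambda>c d. sweedler (\<lambda>p q. G a c p q) d) r) x"
    if "\<And>b c d. lin s (\<lambda>a. G a b c d)" "\<And>a c d. lin s (\<lambda>b. G a b c d)"
      "\<And>a b d. lin s (\<lambda>c. G a b c d)" "\<And>a b c. lin s (\<lambda>d. G a b c d)" for G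
    by (intro sweedler_coassoc[OF s] that s lin_sweedler_fun lin_sweedler_arg bilinear_onI lin_ident)
  ultimately show ?thesis using F by simp
qed


text \<open>Stated for an arbitrary operation because the product and \<open>\<rhd>\<close> satisfy the same axiom.\<close>

lemma sweedler_product:
  assumes m: "bilinear_on scale scale scale UNIV UNIV m"
    and comult: "\<And>x y. \<Delta> (m x y) = tensor_lift scale UNIV (\<lambda>x1 x2. tensor_lift scale UNIV
      (\<lambda>y1 y2. pure_tensor scale scale (m x1 y1) (m x2 y2)) (\<Delta> y)) (\<Delta> x)"
    and s: "vector_space s" and F: "bilinear_on scale scale s UNIV UNIV F"
  shows "sweedler F (m x y) = sweedler (\<lambda>x1 x2. sweedler (\<lambda>y1 y2. F (m x1 y1) (m x2 y2)) y) x"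
proof -
  obtain E where E: "linear_on tensor_scale s UNIV E"
    "\<And>x y. E (pure_tensor scale scale x y) = F x y" "\<And>x. E (\<Delta> x) = sweedler F x"
    by (rule comult_extension[OF s F]) blast
  have lin_m: "lin scale (\<lambda>x. m (f x) y)" "lin scale (\<lambda>x. m y (f x))" if "lin scale f" for f y
    using linear_on_compose[OF bilinear_onD1[OF m] that] linear_on_compose[OF bilinear_onD2[OF m] that] .
  have "tensor_lift scale UNIV (\<lambda>y1 y2. pure_tensor scale scale (m x1 y1) (m x2 y2)) (\<Delta> y)
      = sweedler (\<lambda>y1 y2. pure_tensor scale scale (m x1 y1) (m x2 y2)) y" for x1 x2
    by (intro tensor_lift_comult[OF vs_tensor] lin_basics lin_m)
  moreover have "tensor_lift scale UNIV (\<lambda>x1 x2. sweedler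
        (\<lambda>y1 y2. pure_tensor scale scale (m x1 y1) (m x2 y2)) y) (\<Delta> x)
      = sweedler (\<lambda>x1 x2. sweedler (\<lambda>y1 y2. pure_tensor scale scale (m x1 y1) (m x2 y2)) y) x"
    by (intro tensor_lift_comult[OF vs_tensor] lin_basics lin_m)
  ultimately have "E (\<Delta> (m x y)) = sweedler (\<lambda>x1 x2. sweedler (\<lambda>y1 y2. F (m x1 y1) (m x2 y2)) y) x"
    by (simp add: comult linear_on_sweedler[OF E(1)] E(2))
  then show ?thesis by (simp add: E(3))
qed

lemma sweedler_morphism:
  assumes f: "lin scale f"
    and comult: "\<And>x. \<Delta> (f x) =
      tensor_lift scale UNIV (\<lambda>x1 x2. pure_tensor scale scale (f x1) (f x2)) (\<Delta> x)"
    and s: "vector_space s" and F: "bilinear_on scale scale s UNIV UNIV F"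
  shows "sweedler F (f x) = sweedler (\<lambda>x1 x2. F (f x1) (f x2)) x"
proof -
  obtain E where E: "linear_on tensor_scale s UNIV E"
    "\<And>x y. E (pure_tensor scale scale x y) = F x y" "\<And>x. E (\<Delta> x) = sweedler F x"
    by (rule comult_extension[OF s F]) blast
  have lin_f: "lin scale (\<lambda>x. f (g x))" if "lin scale g" for g
    using linear_on_compose[OF f that] .
  have "tensor_lift scale UNIV (\<lambda>x1 x2. pure_tensor scale scale (f x1) (f x2)) (\<Delta> x)
      = sweedler (\<lambda>x1 x2. pure_tensor scale scale (f x1) (f x2)) x"
    by (intro tensor_lift_comult[OF vs_tensor] lin_basics lin_f)
  then have "E (\<Delta> (f x)) = sweedler (\<lambda>x1 x2. F (f x1) (f x2)) x"
    by (simp add: comult linear_on_sweedler[OF E(1)] E(2))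
  then show ?thesis by (simp add: E(3))
qed

lemma sweedler_group_like:
  assumes g: "\<Delta> g = pure_tensor scale scale g g"
    and s: "vector_space s" and F: "bilinear_on scale scale s UNIV UNIV F"
  shows "sweedler F g = F g g"
  using tensor_lift_comult[OF s F, of g] tensor_lift_pure[OF vector_space_axioms s F, of g g]
  by (simp add: g)

end

section \<open>The sub-adjacent product\<close>

context weak_twisted_post_hopf_algebra
begin

sublocale cocommutative_coalgebra scale comult counit
  by unfold_locales (use cocommutative in simp)

abbreviation circ :: "'h \<Rightarrow> 'h \<Rightarrow> 'h" (infixl \<open>\<odot>\<close> 70) where
  "x \<odot> y \<equiv> sub_adjacent scale mult comult rhd \<Phi> x y"

lemma lin_mult: "lin scale f \<Longrightarrow> lin scale (\<lambda>x. f x \<bullet> y)" "lin scale f \<Longrightarrow> lin scale (\<lambda>x. y \<bullet> f x)"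
  by (rule linear_on_compose[OF bilinear_onD1[OF mult_bilinear]]
      linear_on_compose[OF bilinear_onD2[OF mult_bilinear]], assumption)+

lemma lin_rhd: "lin scale f \<Longrightarrow> lin scale (\<lambda>x. f x \<rhd> y)" "lin scale f \<Longrightarrow> lin scale (\<lambda>x. y \<rhd> f x)"
  by (rule linear_on_compose[OF bilinear_onD1[OF rhd_bilinear]]
      linear_on_compose[OF bilinear_onD2[OF rhd_bilinear]], assumption)+

lemma lin_Phi: "lin scale f \<Longrightarrow> lin scale (\<lambda>x. \<Phi> (f x))"
  by (rule linear_on_compose[OF Phi_linear])

lemma lin_antipode: "lin scale f \<Longrightarrow> lin scale (\<lambda>x. S (f x))"
  by (rule linear_on_compose[OF antipode_linear])

lemmas lin_ops = lin_basics lin_mult lin_rhd lin_Phi lin_antipode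

lemma circ_eq: "x \<odot> y = sweedler (\<lambda>a b. \<Phi> a \<bullet> (b \<rhd> y)) x"
  unfolding sub_adjacent_def by (intro tensor_lift_comult[OF vector_space_axioms] lin_ops)

lemma lin_circ: "lin scale f \<Longrightarrow> lin scale (\<lambda>x. f x \<odot> y)" "lin scale f \<Longrightarrow> lin scale (\<lambda>x. y \<odot> f x)"
  unfolding circ_eq by (intro lin_ops | assumption)+

lemmas lin_all = lin_ops lin_circ

lemma circ_bilinear: "bilinear_on scale scale scale UNIV UNIV circ"
  by (intro lin_all)

lemmas sweedler_mult = sweedler_product[OF mult_bilinear comult_mult[OF UNIV_I UNIV_I]]
lemmas sweedler_rhd = sweedler_product[OF rhd_bilinear rhd_comult]
lemmas sweedler_Phi = sweedler_morphism[OF Phi_linear Phi_comult]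
lemmas sweedler_one = sweedler_group_like[OF comult_one]

text \<open>The product \<open>\<odot>\<close> respects comultiplication: expanding the coproduct of
  \<open>\<Phi>(x\<^sub>1) (x\<^sub>2 \<rhd> y)\<close> distributes four parts of \<open>x\<close> as \<open>\<Phi>(x\<^sub>1) (x\<^sub>3 \<rhd> y\<^sub>1)\<close> and \<open>\<Phi>(x\<^sub>2) (x\<^sub>4 \<rhd> y\<^sub>2)\<close>, and swapping the middle parts
  yields \<open>x\<^sub>1 \<odot> y\<^sub>1\<close> and \<open>x\<^sub>2 \<odot> y\<^sub>2\<close>.\<close>

lemma sweedler_circ:
  assumes s: "vector_space s" and F: "bilinear_on scale scale s UNIV UNIV F"
  shows "sweedler F (x \<odot> y) = sweedler (\<lambda>x1 x2. sweedler (\<lambda>y1 y2. F (x1 \<odot> y1) (x2 \<odot> y2)) y) x"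
proof -
  have lin_F: "lin s (\<lambda>x. F (f x) y)" "lin s (\<lambda>x. F y (f x))" if "lin scale f" for f y
    using linear_on_compose[OF bilinear_onD1[OF F] that] linear_on_compose[OF bilinear_onD2[OF F] that] .
  note lins = lin_all lin_F s
  have lin_sw_F: "lin s (sweedler F)"
    using lin_sweedler_arg[OF s F lin_ident] by simp
  have "sweedler F (x \<odot> y) = sweedler (\<lambda>a b. sweedler F (\<Phi> a \<bullet> (b \<rhd> y))) x"
    unfolding circ_eq by (rule linear_on_sweedler[OF lin_sw_F])
  also have "\<dots> = sweedler (\<lambda>a b. sweedler (\<lambda>a1 a2. sweedler (\<lambda>b1 b2.
      sweedler (\<lambda>y1 y2. F (\<Phi> a1 \<bullet> (b1 \<rhd> y1)) (\<Phi> a2 \<bullet> (b2 \<rhd> y2))) y) b) a) x"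
  proof -
    have "sweedler F (\<Phi> a \<bullet> (b \<rhd> y)) = sweedler (\<lambda>a1 a2. sweedler (\<lambda>b1 b2.
      sweedler (\<lambda>y1 y2. F (\<Phi> a1 \<bullet> (b1 \<rhd> y1)) (\<Phi> a2 \<bullet> (b2 \<rhd> y2))) y) b) a" for a b
    proof -
      have "sweedler F (\<Phi> a \<bullet> (b \<rhd> y))
          = sweedler (\<lambda>p1 p2. sweedler (\<lambda>q1 q2. F (p1 \<bullet> q1) (p2 \<bullet> q2)) (b \<rhd> y)) (\<Phi> a)"
        by (intro sweedler_mult[OF s] F)
      also have "\<dots> = sweedler (\<lambda>a1 a2. sweedler (\<lambda>q1 q2. F (\<Phi> a1 \<bullet> q1) (\<Phi> a2 \<bullet> q2)) (b \<rhd> y)) a"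
        by (intro sweedler_Phi[OF s] lins)
      also have "(\<lambda>a1 a2. sweedler (\<lambda>q1 q2. F (\<Phi> a1 \<bullet> q1) (\<Phi> a2 \<bullet> q2)) (b \<rhd> y))
          = (\<lambda>a1 a2. sweedler (\<lambda>b1 b2. sweedler (\<lambda>y1 y2.
              F (\<Phi> a1 \<bullet> (b1 \<rhd> y1)) (\<Phi> a2 \<bullet> (b2 \<rhd> y2))) y) b)"
        by (intro ext sweedler_rhd[OF s] lins)
      finally show ?thesis .
    qed
    then show ?thesis by simp
  qed
  also have "\<dots> = sweedler (\<lambda>a b. sweedler (\<lambda>a1 a2. sweedler (\<lambda>b1 b2.
      sweedler (\<lambda>y1 y2. F (\<Phi> a1 \<bullet> (a2 \<rhd> y1)) (\<Phi> b1 \<bullet> (b2 \<rhd> y2))) y) b) a) x"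
    by (intro sweedler_middle_swap[OF s] lins)
  also have "\<dots> = sweedler (\<lambda>x1 x2. sweedler (\<lambda>y1 y2. F (x1 \<odot> y1) (x2 \<odot> y2)) y) x"
  proof -
    have "F (x1 \<odot> y1) (x2 \<odot> y2)
        = sweedler (\<lambda>a1 a2. sweedler (\<lambda>b1 b2. F (\<Phi> a1 \<bullet> (a2 \<rhd> y1)) (\<Phi> b1 \<bullet> (b2 \<rhd> y2))) x2) x1"
      for x1 x2 y1 y2
      by (simp add: circ_eq linear_on_sweedler[OF bilinear_onD1[OF F]]
          linear_on_sweedler[OF bilinear_onD2[OF F]]) (rule sweedler_exchange)
    then show ?thesis
      by (simp add: sweedler_exchange[where y = y])
  qed
  finally show ?thesis .
qed

text \<open>Both sides equal \<open>\<Phi>(x\<^sub>1) (x\<^sub>2 \<rhd> \<Phi>(y\<^sub>1)) (x\<^sub>3 \<rhd> (y\<^sub>2 \<rhd> z))\<close>: on the left because of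
  \<open>\<Phi>(x \<odot> y) = x \<odot> \<Phi>(y)\<close> and \<open>(x \<odot> y) \<rhd> z = x \<rhd> (y \<rhd> z)\<close>, on the right because \<open>\<rhd>\<close> distributes
  over the product.\<close>

lemma circ_assoc: "(x \<odot> y) \<odot> z = x \<odot> (y \<odot> z)"
proof -
  have "(x \<odot> y) \<odot> z = sweedler (\<lambda>p q. \<Phi> p \<bullet> (q \<rhd> z)) (x \<odot> y)"
    by (rule circ_eq)
  also have "\<dots> = sweedler (\<lambda>x1 x2. sweedler (\<lambda>y1 y2. \<Phi> (x1 \<odot> y1) \<bullet> ((x2 \<odot> y2) \<rhd> z)) y) x"
    by (intro sweedler_circ[OF vector_space_axioms] lin_all)
  also have "\<dots> = sweedler (\<lambda>x1 x2. sweedler (\<lambda>y1 y2. (x1 \<odot> \<Phi> y1) \<bullet> (x2 \<rhd> (y2 \<rhd> z))) y) x"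
    by (simp add: Phi_sub_adjacent rhd_rhd)
  also have "\<dots> = sweedler (\<lambda>y1 y2. sweedler (\<lambda>x1 x2. sweedler (\<lambda>a b.
      (\<Phi> a \<bullet> (b \<rhd> \<Phi> y1)) \<bullet> (x2 \<rhd> (y2 \<rhd> z))) x1) x) y"
    by (subst sweedler_exchange)
      (simp add: circ_eq linear_on_sweedler[OF lin_mult(1)[OF lin_ident]])
  also have "\<dots> = sweedler (\<lambda>y1 y2. sweedler (\<lambda>a x2. sweedler (\<lambda>b c.
      (\<Phi> a \<bullet> (b \<rhd> \<Phi> y1)) \<bullet> (c \<rhd> (y2 \<rhd> z))) x2) x) y"
    by (subst sweedler_coassoc[OF vector_space_axioms]) (intro lin_all refl)+
  also have "\<dots> = sweedler (\<lambda>y1 y2. sweedler (\<lambda>a b. \<Phi> a \<bullet> (b \<rhd> (\<Phi> y1 \<bullet> (y2 \<rhd> z)))) x) y"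
  proof -
    have "b \<rhd> (u \<bullet> v) = sweedler (\<lambda>b1 b2. (b1 \<rhd> u) \<bullet> (b2 \<rhd> v)) b" for b u v
      unfolding rhd_mult by (intro tensor_lift_comult[OF vector_space_axioms] lin_all)
    then show ?thesis
      by (simp add: linear_on_sweedler[OF lin_mult(2)[OF lin_ident]] mult_assoc)
  qed
  also have "\<dots> = x \<odot> (y \<odot> z)"
    by (subst sweedler_exchange)
      (simp add: circ_eq linear_on_sweedler[OF lin_mult(2)[OF lin_ident]]
        linear_on_sweedler[OF lin_rhd(2)[OF lin_ident]])
  finally show ?thesis .
qed


text \<open>An idempotent \<open>f * f = f\<close> with a convolution inverse is the unit \<open>x \<mapsto> \<epsilon>(x) 1\<close>; this is applied to
  \<open>f(x) = x \<rhd> 1\<close>, which is idempotent because \<open>1 1 = 1\<close> and invertible because it is a coalgebra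
  morphism.\<close>

lemma rhd_one: "x \<rhd> \<one> = \<epsilon> x *s \<one>"
proof -
  have mult_conv: "sweedler (\<lambda>a b. (a \<rhd> \<one>) \<bullet> (b \<rhd> \<one>)) x = x \<rhd> \<one>" for x
  proof -
    have "x \<rhd> \<one> = x \<rhd> (\<one> \<bullet> \<one>)" by (simp add: one_left)
    also have "\<dots> = sweedler (\<lambda>a b. (a \<rhd> \<one>) \<bullet> (b \<rhd> \<one>)) x"
      unfolding rhd_mult by (intro tensor_lift_comult[OF vector_space_axioms] lin_ops)
    finally show ?thesis ..
  qed
  have inv: "sweedler (\<lambda>a b. S (a \<rhd> \<one>) \<bullet> (b \<rhd> \<one>)) x = \<epsilon> x *s \<one>" for x
  proof -
    have "sweedler (\<lambda>a b. S (a \<rhd> \<one>) \<bullet> (b \<rhd> \<one>)) x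
        = sweedler (\<lambda>a b. sweedler (\<lambda>c d. S (a \<rhd> c) \<bullet> (b \<rhd> d)) \<one>) x"
      by (subst sweedler_one[OF vector_space_axioms]) (intro lin_ops refl)+
    also have "\<dots> = sweedler (\<lambda>p q. S p \<bullet> q) (x \<rhd> \<one>)"
      by (intro sweedler_rhd[OF vector_space_axioms, symmetric] lin_ops)
    also have "\<dots> = \<epsilon> (x \<rhd> \<one>) *s \<one>"
      by (subst tensor_lift_comult[OF vector_space_axioms, symmetric])
        (intro antipode_left lin_ops UNIV_I)+
    finally show ?thesis by (simp add: rhd_counit counit_one)
  qed
  have "x \<rhd> \<one> = sweedler (\<lambda>a b. \<epsilon> a *s (b \<rhd> \<one>)) x"
    by (intro sweedler_counit_left[symmetric] lin_ops)
  also have "\<dots> = sweedler (\<lambda>a b. (\<epsilon> a *s \<one>) \<bullet> (b \<rhd> \<one>)) x"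
    by (simp add: linear_on_scale[OF lin_mult(1)[OF lin_ident]] one_left)
  also have "\<dots> = sweedler (\<lambda>a b. sweedler (\<lambda>c d. (S (c \<rhd> \<one>) \<bullet> (d \<rhd> \<one>)) \<bullet> (b \<rhd> \<one>)) a) x"
    by (simp flip: inv add: linear_on_sweedler[OF lin_mult(1)[OF lin_ident]])
  also have "\<dots> = sweedler (\<lambda>c b. sweedler (\<lambda>d b. (S (c \<rhd> \<one>) \<bullet> (d \<rhd> \<one>)) \<bullet> (b \<rhd> \<one>)) b) x"
    by (intro sweedler_coassoc[OF vector_space_axioms] lin_ops)
  also have "\<dots> = sweedler (\<lambda>c b. S (c \<rhd> \<one>) \<bullet> sweedler (\<lambda>d b. (d \<rhd> \<one>) \<bullet> (b \<rhd> \<one>)) b) x"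
    by (simp add: linear_on_sweedler[OF lin_mult(2)[OF lin_ident]] mult_assoc)
  also have "\<dots> = \<epsilon> x *s \<one>"
    by (simp add: mult_conv inv)
  finally show ?thesis .
qed

lemma circ_one: "x \<odot> \<one> = \<Phi> x"
proof -
  have "x \<odot> \<one> = sweedler (\<lambda>a b. \<epsilon> b *s \<Phi> a) x"
    by (simp add: circ_eq rhd_one linear_on_scale[OF lin_mult(2)[OF lin_ident]] one_right)
  also have "\<dots> = \<Phi> x"
    by (intro sweedler_counit_right lin_ops)
  finally show ?thesis .
qed

lemma counit_circ: "\<epsilon> (x \<odot> y) = \<epsilon> x * \<epsilon> y"
proof -
  have "\<epsilon> (x \<odot> y) = sweedler (\<lambda>a b. \<epsilon> a * (\<epsilon> b * \<epsilon> y)) x"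
    by (simp add: circ_eq linear_on_sweedler[OF counit_linear] counit_mult rhd_counit Phi_counit)
  also have "\<dots> = \<epsilon> x * \<epsilon> y"
    by (rule sweedler_counit_left[where f = "\<lambda>x. \<epsilon> x * \<epsilon> y"])
      (use counit_linear in \<open>simp add: linear_on_def algebra_simps\<close>)
  finally show ?thesis .
qed

lemma circ_convolution:
  assumes f: "lin scale f"
  shows "sweedler (\<lambda>a b. a \<odot> f b) x = sweedler (\<lambda>a b. \<Phi> a \<bullet> sweedler (\<lambda>c d. c \<rhd> f d) b) x"
proof -
  have lin_f: "lin scale (\<lambda>x. f (g x))" if "lin scale g" for g
    using linear_on_compose[OF f that] .
  have "sweedler (\<lambda>a b. a \<odot> f b) x = sweedler (\<lambda>a b. sweedler (\<lambda>c d. \<Phi> c \<bullet> (d \<rhd> f b)) a) x"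
    by (simp add: circ_eq)
  also have "\<dots> = sweedler (\<lambda>a b. sweedler (\<lambda>c d. \<Phi> a \<bullet> (c \<rhd> f d)) b) x"
    by (intro sweedler_coassoc[OF vector_space_axioms] lin_all lin_f)
  finally show ?thesis
    by (simp add: linear_on_sweedler[OF lin_mult(2)[OF lin_ident]])
qed

lemma antipode_Phi_left: "sweedler (\<lambda>a b. S (\<Phi> a) \<bullet> \<Phi> b) x = \<epsilon> x *s \<one>"
proof -
  have "sweedler (\<lambda>a b. S (\<Phi> a) \<bullet> \<Phi> b) x = sweedler (\<lambda>a b. S a \<bullet> b) (\<Phi> x)"
    by (intro sweedler_Phi[OF vector_space_axioms, symmetric] lin_ops)
  also have "\<dots> = \<epsilon> (\<Phi> x) *s \<one>"
    by (subst tensor_lift_comult[OF vector_space_axioms, symmetric])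
      (intro antipode_left lin_ops UNIV_I)+
  finally show ?thesis by (simp add: Phi_counit)
qed

lemma antipode_Phi_right: "sweedler (\<lambda>a b. \<Phi> a \<bullet> S (\<Phi> b)) x = \<epsilon> x *s \<one>"
proof -
  have "sweedler (\<lambda>a b. \<Phi> a \<bullet> S (\<Phi> b)) x = sweedler (\<lambda>a b. a \<bullet> S b) (\<Phi> x)"
    by (intro sweedler_Phi[OF vector_space_axioms, symmetric] lin_ops)
  also have "\<dots> = \<epsilon> (\<Phi> x) *s \<one>"
    by (subst tensor_lift_comult[OF vector_space_axioms, symmetric])
      (intro antipode_right lin_ops UNIV_I)+
  finally show ?thesis by (simp add: Phi_counit)
qed

text \<open>The map \<open>x \<mapsto> S(\<Phi>(x))\<close> is a convolution inverse of the coalgebra morphism \<open>\<Phi>\<close>, so it removes the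
  left factor in \<open>x\<^sub>1 \<odot> f(x\<^sub>2) = \<Phi>(x\<^sub>1) (x\<^sub>2 \<rhd> f(x\<^sub>3))\<close>.\<close>

lemma circ_convolution_undo_Phi:
  assumes f: "lin scale f"
  shows "sweedler (\<lambda>a b. S (\<Phi> a) \<bullet> sweedler (\<lambda>c d. c \<odot> f d) b) x = sweedler (\<lambda>a b. a \<rhd> f b) x"
proof -
  have lin_f: "lin scale (\<lambda>x. f (g x))" if "lin scale g" for g
    using linear_on_compose[OF f that] .
  let ?k = "\<lambda>x. sweedler (\<lambda>a b. a \<rhd> f b) x"
  have "sweedler (\<lambda>a b. S (\<Phi> a) \<bullet> sweedler (\<lambda>c d. c \<odot> f d) b) x
      = sweedler (\<lambda>a b. sweedler (\<lambda>c d. (S (\<Phi> a) \<bullet> \<Phi> c) \<bullet> ?k d) b) x"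
    by (simp add: circ_convolution[OF f] linear_on_sweedler[OF lin_mult(2)[OF lin_ident]] mult_assoc)
  also have "\<dots> = sweedler (\<lambda>a b. sweedler (\<lambda>c d. (S (\<Phi> c) \<bullet> \<Phi> d) \<bullet> ?k b) a) x"
    by (intro sweedler_coassoc[OF vector_space_axioms, symmetric] lin_all lin_f)
  also have "\<dots> = sweedler (\<lambda>a b. (\<epsilon> a *s \<one>) \<bullet> ?k b) x"
    by (simp add: antipode_Phi_left flip: linear_on_sweedler[OF lin_mult(1)[OF lin_ident]])
  also have "\<dots> = sweedler (\<lambda>a b. \<epsilon> a *s ?k b) x"
    by (simp add: linear_on_scale[OF lin_mult(1)[OF lin_ident]] one_left)
  also have "\<dots> = ?k x"
    by (intro sweedler_counit_left lin_all lin_f)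
  finally show ?thesis .
qed

end

section \<open>Consequences of convolution invertibility\<close>

context twisted_post_hopf_algebra
begin

abbreviation T :: "'h \<Rightarrow> 'h \<Rightarrow> 'h" where
  "T \<equiv> T_rhd scale comult counit rhd"

lemma convolution_inverse_T: "convolution_inverse scale comult counit rhd T"
  unfolding T_rhd_def by (rule theI'[OF convolution_invertible])

lemma lin_T: "lin scale f \<Longrightarrow> lin scale (\<lambda>x. T (f x) y)" "lin scale f \<Longrightarrow> lin scale (\<lambda>x. T y (f x))"
  using convolution_inverse_T
  by (auto simp: convolution_inverse_def linear_on_def fun_scale_def fun_eq_iff)

lemmas lin_twisted = lin_all lin_T

lemma
  shows sweedler_rhd_T: "sweedler (\<lambda>a b. a \<rhd> T b z) x = \<epsilon> x *s z"
    and sweedler_T_rhd: "sweedler (\<lambda>a b. T a (b \<rhd> z)) x = \<epsilon> x *s z"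
proof -
  have eval: "linear_on (fun_scale scale) scale UNIV (\<lambda>f. f z)"
    by (rule linear_onI) (auto simp: fun_scale_def)
  have lift: "tensor_lift scale UNIV F (\<Delta> x) z = sweedler (\<lambda>a b. F a b z) x"
    if "\<And>b z. lin scale (\<lambda>a. F a b z)" "\<And>a z. lin scale (\<lambda>b. F a b z)" for F :: "'h \<Rightarrow> 'h \<Rightarrow> 'h \<Rightarrow> 'h"
  proof -
    have "bilinear_on scale scale (fun_scale scale) UNIV UNIV F"
      using that by (simp add: bilinear_on_def linear_on_def fun_scale_def fun_eq_iff)
    from tensor_lift_comult[OF vector_space_fun_scale[OF vector_space_axioms] this, of x]
    show ?thesis by (simp add: linear_on_sweedler[OF eval])
  qed
  have "tensor_lift scale UNIV (\<lambda>a b. rhd a \<circ> T b) (\<Delta> x) z = sweedler (\<lambda>a b. (rhd a \<circ> T b) z) x"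
    by (rule lift; unfold o_def; intro lin_twisted)
  then show "sweedler (\<lambda>a b. a \<rhd> T b z) x = \<epsilon> x *s z"
    using convolution_inverse_T by (simp add: convolution_inverse_def)
  have "tensor_lift scale UNIV (\<lambda>a b. T a \<circ> rhd b) (\<Delta> x) z = sweedler (\<lambda>a b. (T a \<circ> rhd b) z) x"
    by (rule lift; unfold o_def; intro lin_twisted)
  then show "sweedler (\<lambda>a b. T a (b \<rhd> z)) x = \<epsilon> x *s z"
    using convolution_inverse_T by (simp add: convolution_inverse_def)
qed

text \<open>The operator \<open>L\<^sub>1\<close> is idempotent as \<open>1 \<odot> 1 = \<Phi>(1) = 1\<close>, and \<open>T\<^sub>1\<close> is a left inverse of it.\<close>

lemma one_rhd: "\<one> \<rhd> x = x"
proof -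
  have T_one: "T \<one> (\<one> \<rhd> z) = z" for z
  proof -
    have "sweedler (\<lambda>a b. T a (b \<rhd> z)) \<one> = T \<one> (\<one> \<rhd> z)"
      by (intro sweedler_one[OF vector_space_axioms] lin_twisted)
    then show ?thesis by (simp add: sweedler_T_rhd counit_one)
  qed
  have "\<one> \<rhd> (\<one> \<rhd> x) = (\<one> \<odot> \<one>) \<rhd> x" by (rule rhd_rhd[symmetric])
  also have "\<dots> = \<one> \<rhd> x" by (simp add: circ_one Phi_one)
  finally have "T \<one> (\<one> \<rhd> (\<one> \<rhd> x)) = T \<one> (\<one> \<rhd> x)" by simp
  then show ?thesis by (simp only: T_one)
qed

lemma one_circ: "\<one> \<odot> x = x"
proof -
  have "\<one> \<odot> x = \<Phi> \<one> \<bullet> (\<one> \<rhd> x)"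
    unfolding circ_eq by (intro sweedler_one[OF vector_space_axioms] lin_twisted)
  then show ?thesis by (simp add: Phi_one one_rhd one_left)
qed

text \<open>Replacing \<open>x\<close> by \<open>x \<odot> 1 = \<Phi>(x)\<close> on the left of a product changes nothing, because \<open>1\<close> is a left unit.\<close>

lemma Phi_circ: "\<Phi> x \<odot> y = x \<odot> y"
  by (simp add: circ_assoc one_circ flip: circ_one)

lemma Phi_Phi: "\<Phi> (\<Phi> x) = \<Phi> x"
  using Phi_circ[of x \<one>] by (simp add: circ_one)

lemma Phi_rhd: "\<Phi> x \<rhd> y = x \<rhd> y"
  using rhd_rhd[of x \<one> y] by (simp add: circ_one one_rhd)

text \<open>Removing \<open>\<Phi>\<close> leaves \<open>x\<^sub>1 \<rhd> f(x\<^sub>2)\<close>, from which \<open>f(x) = T(x\<^sub>1)(x\<^sub>2 \<rhd> f(x\<^sub>3))\<close> is recovered.\<close>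

lemma convolution_circ_cancel:
  assumes f: "lin scale f" and g: "lin scale g"
    and eq: "\<And>x. sweedler (\<lambda>a b. a \<odot> f b) x = sweedler (\<lambda>a b. a \<odot> g b) x"
  shows "f x = g x"
proof -
  have recover: "sweedler (\<lambda>a b. T a (sweedler (\<lambda>c d. c \<rhd> h d) b)) x = h x" if h: "lin scale h" for h x
  proof -
    have lin_h: "lin scale (\<lambda>x. h (g x))" if "lin scale g" for g
      using linear_on_compose[OF h that] .
    have "sweedler (\<lambda>a b. T a (sweedler (\<lambda>c d. c \<rhd> h d) b)) x
        = sweedler (\<lambda>a b. sweedler (\<lambda>c d. T a (c \<rhd> h d)) b) x"
      by (simp add: linear_on_sweedler[OF lin_T(2)[OF lin_ident]])
    also have "\<dots> = sweedler (\<lambda>a b. sweedler (\<lambda>c d. T c (d \<rhd> h b)) a) x"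
      by (intro sweedler_coassoc[OF vector_space_axioms, symmetric] lin_twisted lin_h)
    also have "\<dots> = sweedler (\<lambda>a b. \<epsilon> a *s h b) x"
      by (simp add: sweedler_T_rhd)
    also have "\<dots> = h x"
      by (rule sweedler_counit_left[OF h])
    finally show ?thesis .
  qed
  have "sweedler (\<lambda>a b. a \<rhd> f b) x = sweedler (\<lambda>a b. a \<rhd> g b) x" for x
    by (simp add: eq flip: circ_convolution_undo_Phi[OF f] circ_convolution_undo_Phi[OF g])
  then show ?thesis
    using recover[OF f, of x] recover[OF g, of x] by simp
qed

section \<open>The antipode\<close>

text \<open>The formula for \<open>S\<^sub>\<rhd>\<close> makes sense on all of \<open>H\<close>, where it is linear. As \<open>\<Phi>\<close> is a coalgebra
  morphism, its value at \<open>\<Phi>(x)\<close> is the prescribed one (\<open>antipode_rhd_Phi\<close>), so \<open>S\<^sub>\<rhd>\<close> is well defined.\<close>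

definition antipode_rhd :: "'h \<Rightarrow> 'h" where
  "antipode_rhd x = sweedler (\<lambda>a b. T a (S b)) x"

lemma lin_antipode_rhd: "lin scale f \<Longrightarrow> lin scale (\<lambda>x. antipode_rhd (f x))"
  unfolding antipode_rhd_def by (intro lin_twisted)

lemma antipode_rhd_Phi: "antipode_rhd (\<Phi> x) = sweedler (\<lambda>a b. T (\<Phi> a) (S (\<Phi> b))) x"
  unfolding antipode_rhd_def by (intro sweedler_Phi[OF vector_space_axioms] lin_twisted)

text \<open>As \<open>L\<^bsub>\<Phi>(x)\<^esub> = L\<^sub>x\<close>, the operators \<open>L\<close> and \<open>T\<close> cancel in \<open>\<Phi>(x\<^sub>1) (x\<^sub>2 \<rhd> S\<^sub>\<rhd>(\<Phi>(x\<^sub>3)))\<close>, and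
  \<open>\<Phi>(x\<^sub>1) S(\<Phi>(x\<^sub>2)) = \<epsilon>(x) 1\<close> is what remains.\<close>

lemma circ_antipode_rhd: "sweedler (\<lambda>a b. a \<odot> antipode_rhd (\<Phi> b)) x = \<epsilon> x *s \<one>"
proof -
  have "sweedler (\<lambda>a b. a \<rhd> antipode_rhd (\<Phi> b)) x = S (\<Phi> x)" for x
  proof -
    have rhd_T_Phi: "sweedler (\<lambda>a b. a \<rhd> T (\<Phi> b) z) x = \<epsilon> x *s z" for x z
    proof -
      have "sweedler (\<lambda>a b. \<Phi> a \<rhd> T (\<Phi> b) z) x = sweedler (\<lambda>a b. a \<rhd> T b z) (\<Phi> x)"
        by (intro sweedler_Phi[OF vector_space_axioms, symmetric] lin_twisted)
      then show ?thesis by (simp add: Phi_rhd sweedler_rhd_T Phi_counit)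
    qed
    have "sweedler (\<lambda>a b. a \<rhd> antipode_rhd (\<Phi> b)) x
        = sweedler (\<lambda>a b. sweedler (\<lambda>c d. a \<rhd> T (\<Phi> c) (S (\<Phi> d))) b) x"
      by (simp add: antipode_rhd_Phi linear_on_sweedler[OF lin_rhd(2)[OF lin_ident]])
    also have "\<dots> = sweedler (\<lambda>a b. sweedler (\<lambda>c d. c \<rhd> T (\<Phi> d) (S (\<Phi> b))) a) x"
      by (intro sweedler_coassoc[OF vector_space_axioms, symmetric] lin_twisted)
    also have "\<dots> = sweedler (\<lambda>a b. \<epsilon> a *s S (\<Phi> b)) x"
      by (simp add: rhd_T_Phi)
    also have "\<dots> = S (\<Phi> x)"
      by (intro sweedler_counit_left lin_twisted)
    finally show ?thesis .
  qed
  then show ?thesis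
    by (simp add: circ_convolution[OF lin_antipode_rhd[OF lin_Phi[OF lin_ident]]] antipode_Phi_right)
qed

text \<open>The values of \<open>S\<^sub>\<rhd>\<close> lie in \<open>\<Phi>(H)\<close>, the fixed points of \<open>\<Phi>\<close>: applying \<open>\<Phi>\<close> to
  \<open>x\<^sub>1 \<odot> S\<^sub>\<rhd>(\<Phi>(x\<^sub>2)) = \<epsilon>(x) 1\<close> moves it onto the right factor and fixes the right side.\<close>

lemma Phi_antipode_rhd: "\<Phi> (antipode_rhd (\<Phi> x)) = antipode_rhd (\<Phi> x)"
proof (rule convolution_circ_cancel[where f = "\<lambda>x. \<Phi> (antipode_rhd (\<Phi> x))"])
  show "lin scale (\<lambda>x. \<Phi> (antipode_rhd (\<Phi> x)))" "lin scale (\<lambda>x. antipode_rhd (\<Phi> x))"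
    by (intro lin_twisted lin_antipode_rhd)+
  have "sweedler (\<lambda>a b. a \<odot> \<Phi> (antipode_rhd (\<Phi> b))) x
      = \<Phi> (sweedler (\<lambda>a b. a \<odot> antipode_rhd (\<Phi> b)) x)" for x
    by (simp add: linear_on_sweedler[OF Phi_linear] Phi_sub_adjacent)
  then show "sweedler (\<lambda>a b. a \<odot> \<Phi> (antipode_rhd (\<Phi> b))) x
      = sweedler (\<lambda>a b. a \<odot> antipode_rhd (\<Phi> b)) x" for x
    by (simp add: circ_antipode_rhd linear_on_scale[OF Phi_linear] Phi_one)
qed

text \<open>The usual argument that a right inverse of a left-cancellable element is a left inverse: multiplied
  by \<open>x\<^sub>1\<close> on the left, both sides become \<open>\<Phi>(x) = x \<odot> 1\<close>.\<close>

lemma antipode_rhd_circ: "sweedler (\<lambda>a b. antipode_rhd (\<Phi> a) \<odot> \<Phi> b) x = \<epsilon> x *s \<one>"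
  (is "?g x = _")
proof (rule convolution_circ_cancel[where f = ?g and g = "\<lambda>x. \<epsilon> x *s \<one>"])
  show "lin scale ?g" "lin scale (\<lambda>x. \<epsilon> x *s \<one>)"
    by (intro lin_twisted lin_antipode_rhd)+
  fix x
  have "sweedler (\<lambda>a b. a \<odot> ?g b) x
      = sweedler (\<lambda>a b. sweedler (\<lambda>c d. (a \<odot> antipode_rhd (\<Phi> c)) \<odot> \<Phi> d) b) x"
    by (simp add: linear_on_sweedler[OF lin_circ(2)[OF lin_ident]] circ_assoc)
  also have "\<dots> = sweedler (\<lambda>a b. sweedler (\<lambda>c d. (c \<odot> antipode_rhd (\<Phi> d)) \<odot> \<Phi> b) a) x"
    by (intro sweedler_coassoc[OF vector_space_axioms, symmetric] lin_twisted lin_antipode_rhd)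
  also have "\<dots> = sweedler (\<lambda>a b. (\<epsilon> a *s \<one>) \<odot> \<Phi> b) x"
    by (simp add: circ_antipode_rhd flip: linear_on_sweedler[OF lin_circ(1)[OF lin_ident]])
  also have "\<dots> = sweedler (\<lambda>a b. \<epsilon> a *s \<Phi> b) x"
    by (simp add: linear_on_scale[OF lin_circ(1)[OF lin_ident]] one_circ)
  also have "\<dots> = \<Phi> x"
    by (intro sweedler_counit_left lin_twisted)
  also have "\<dots> = x \<odot> \<one>"
    by (simp add: circ_one)
  also have "\<dots> = sweedler (\<lambda>a b. \<epsilon> b *s (a \<odot> \<one>)) x"
    by (intro sweedler_counit_right[symmetric] lin_twisted)
  also have "\<dots> = sweedler (\<lambda>a b. a \<odot> (\<epsilon> b *s \<one>)) x"
    by (simp add: linear_on_scale[OF lin_circ(2)[OF lin_ident]])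
  finally show "sweedler (\<lambda>a b. a \<odot> ?g b) x = sweedler (\<lambda>a b. a \<odot> (\<epsilon> b *s \<one>)) x" .
qed

section \<open>Restriction to the image of \<open>\<Phi>\<close>\<close>

lemma range_Phi_iff: "x \<in> range \<Phi> \<longleftrightarrow> \<Phi> x = x"
  using Phi_Phi by (metis rangeE rangeI)

lemma subspace_range_Phi: "subspace (range \<Phi>)"
proof (rule subspaceI)
  have "\<Phi> 0 + \<Phi> 0 = \<Phi> 0" by (simp flip: linear_on_add[OF Phi_linear])
  then show "0 \<in> range \<Phi>" by (simp add: range_Phi_iff)
qed (simp_all add: range_Phi_iff linear_on_add[OF Phi_linear] linear_on_scale[OF Phi_linear])

lemma comult_range_Phi:
  assumes "x \<in> range \<Phi>"
  shows "\<Delta> x \<in> tensor_space scale (range \<Phi>)"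
proof -
  obtain y where x: "x = \<Phi> y" using assms by blast
  have "\<Delta> x = sweedler (\<lambda>a b. pure_tensor scale scale (\<Phi> a) (\<Phi> b)) y"
    unfolding x Phi_comult by (intro tensor_lift_comult[OF vs_tensor] lin_ops)
  also have "\<dots> = (\<Sum>(a, b)\<leftarrow>map (map_prod \<Phi> \<Phi>) (comult_list y). pure_tensor scale scale a b)"
    by (simp add: sweedler_def comp_def case_prod_unfold)
  also have "\<dots> \<in> tensor_space scale (range \<Phi>)"
    unfolding tensor_space_eq_sums[OF vector_space_axioms subspace_range_Phi]
    by (rule CollectI, rule exI, rule conjI, rule refl) auto
  finally show ?thesis .
qed

lemma tensor_lift_range_Phi:
  assumes s: "vector_space s" and F: "bilinear_on scale scale s UNIV UNIV F"
    and f: "\<And>x y. x \<in> range \<Phi> \<Longrightarrow> y \<in> range \<Phi> \<Longrightarrow> f x y = F x y" and x: "x \<in> range \<Phi>"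
  shows "tensor_lift scale (range \<Phi>) f (\<Delta> x) = sweedler F x"
  using tensor_lift_subspace[OF vector_space_axioms s subspace_range_Phi F f comult_range_Phi[OF x]]
  by (simp add: tensor_lift_comult[OF s F])

lemma linear_on_subset: "linear_on s1 s2 UNIV f \<Longrightarrow> linear_on s1 s2 A f"
  by (simp add: linear_on_def)

lemma circ_closed: "y \<in> range \<Phi> \<Longrightarrow> x \<odot> y \<in> range \<Phi>"
  by (simp add: range_Phi_iff Phi_sub_adjacent)

lemma bialgebra_range_Phi:
  "cocommutative_bialgebra_on scale (range \<Phi>) circ \<one> comult counit"
proof unfold_locales
  let ?A = "range \<Phi>" and ?pt = "pure_tensor scale scale" and ?pt' = "pure_tensor scale tensor_scale"
  show "subspace ?A" by (rule subspace_range_Phi)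
  show "x \<odot> y \<in> ?A" if "x \<in> ?A" "y \<in> ?A" for x y
    using that by (intro circ_closed)
  show "bilinear_on scale scale scale ?A ?A circ"
    using circ_bilinear by (simp add: bilinear_on_def linear_on_def)
  show "(x \<odot> y) \<odot> z = x \<odot> (y \<odot> z)" for x y z
    by (rule circ_assoc)
  show "\<one> \<in> ?A" by (simp add: range_Phi_iff Phi_one)
  show "\<one> \<odot> x = x" for x by (rule one_circ)
  show "x \<odot> \<one> = x" if "x \<in> ?A" for x
    using that by (simp add: circ_one range_Phi_iff)
  show "\<Delta> x \<in> tensor_space scale ?A" if "x \<in> ?A" for x
    using that by (rule comult_range_Phi)
  show "linear_on scale tensor_scale ?A \<Delta>" by (rule linear_on_subset[OF comult_linear])
  show "linear_on scale (*) ?A \<epsilon>" by (rule linear_on_subset[OF counit_linear])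
  show "tensor_lift scale ?A (\<lambda>a b. tensor_lift scale ?A (\<lambda>a1 a2. ?pt' a1 (?pt a2 b)) (\<Delta> a)) (\<Delta> x)
      = tensor_lift scale ?A (\<lambda>a b. ?pt' a (\<Delta> b)) (\<Delta> x)" if x: "x \<in> ?A" for x
  proof -
    have "tensor_lift scale ?A (\<lambda>a b. tensor_lift scale ?A (\<lambda>a1 a2. ?pt' a1 (?pt a2 b)) (\<Delta> a)) (\<Delta> x)
        = sweedler (\<lambda>a b. sweedler (\<lambda>a1 a2. ?pt' a1 (?pt a2 b)) a) x"
      by (intro tensor_lift_range_Phi[OF vs_tensor] lin_ops refl x)
    also have "\<dots> = sweedler (\<lambda>a b. sweedler (\<lambda>c d. ?pt' a (?pt c d)) b) x"
      by (intro sweedler_coassoc[OF vs_tensor] lin_ops)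
    also have "\<dots> = sweedler (\<lambda>a b. ?pt' a (\<Delta> b)) x"
      by (subst comult_eq_sweedler) (simp add: linear_on_sweedler[OF bilinear_onD2[OF bilinear_on_pure_tensor]])
    also have "\<dots> = tensor_lift scale ?A (\<lambda>a b. ?pt' a (\<Delta> b)) (\<Delta> x)"
      by (intro tensor_lift_range_Phi[OF vs_tensor, symmetric] lin_ops lin_comult refl x)
    finally show ?thesis .
  qed
  show "tensor_lift scale ?A (\<lambda>a b. \<epsilon> a *s b) (\<Delta> x) = x" if x: "x \<in> ?A" for x
  proof -
    have "tensor_lift scale ?A (\<lambda>a b. \<epsilon> a *s b) (\<Delta> x) = sweedler (\<lambda>a b. \<epsilon> a *s b) x"
      by (intro tensor_lift_range_Phi[OF vector_space_axioms] lin_ops refl x)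
    also have "\<dots> = x" by (rule sweedler_counit_left[OF lin_ident])
    finally show ?thesis .
  qed
  show "tensor_lift scale ?A (\<lambda>a b. \<epsilon> b *s a) (\<Delta> x) = x" if x: "x \<in> ?A" for x
  proof -
    have "tensor_lift scale ?A (\<lambda>a b. \<epsilon> b *s a) (\<Delta> x) = sweedler (\<lambda>a b. \<epsilon> b *s a) x"
      by (intro tensor_lift_range_Phi[OF vector_space_axioms] lin_ops refl x)
    also have "\<dots> = x" by (rule sweedler_counit_right[OF lin_ident])
    finally show ?thesis .
  qed
  show "\<Delta> (x \<odot> y) = tensor_lift scale ?A (\<lambda>x1 x2. tensor_lift scale ?A
      (\<lambda>y1 y2. ?pt (x1 \<odot> y1) (x2 \<odot> y2)) (\<Delta> y)) (\<Delta> x)" if x: "x \<in> ?A" and y: "y \<in> ?A" for x y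
  proof -
    have "\<Delta> (x \<odot> y) = sweedler ?pt (x \<odot> y)" by (rule comult_eq_sweedler)
    also have "\<dots> = sweedler (\<lambda>x1 x2. sweedler (\<lambda>y1 y2. ?pt (x1 \<odot> y1) (x2 \<odot> y2)) y) x"
      by (intro sweedler_circ[OF vs_tensor] lin_all)
    also have "\<dots> = tensor_lift scale ?A (\<lambda>x1 x2. tensor_lift scale ?A
        (\<lambda>y1 y2. ?pt (x1 \<odot> y1) (x2 \<odot> y2)) (\<Delta> y)) (\<Delta> x)"
      by (intro tensor_lift_range_Phi[OF vs_tensor] tensor_lift_range_Phi[OF vs_tensor, symmetric]
          lin_all refl x y)
    finally show ?thesis .
  qed
  show "\<Delta> \<one> = ?pt \<one> \<one>" by (rule comult_one)
  show "\<epsilon> (x \<odot> y) = \<epsilon> x * \<epsilon> y" for x y by (rule counit_circ)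
  show "\<epsilon> \<one> = 1" by (rule counit_one)
  show "tensor_lift scale ?A (\<lambda>a b. ?pt b a) (\<Delta> x) = \<Delta> x" if x: "x \<in> ?A" for x
  proof -
    have "tensor_lift scale ?A (\<lambda>a b. ?pt b a) (\<Delta> x) = sweedler (\<lambda>a b. ?pt b a) x"
      by (intro tensor_lift_range_Phi[OF vs_tensor] lin_ops refl x)
    also have "\<dots> = sweedler ?pt x"
      by (intro sweedler_cocomm[OF vs_tensor] lin_ops)
    finally show ?thesis by (simp flip: comult_eq_sweedler)
  qed
qed

text \<open>The maps admitted as \<open>S\<^sub>\<rhd>\<close> are the functions that agree with \<open>antipode_rhd\<close> on \<open>\<Phi>(H)\<close>. They
  need not be linear elsewhere, which is why sums involving them are compared on \<open>\<Phi>(H)\<close> with sums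
  involving \<open>antipode_rhd\<close>.\<close>

lemma is_S_rhd_iff:
  "is_S_rhd scale comult counit S rhd \<Phi> R \<longleftrightarrow> (\<forall>x\<in>range \<Phi>. R x = antipode_rhd x)"
proof -
  have "tensor_lift scale UNIV (\<lambda>a b. T (\<Phi> a) (S (\<Phi> b))) (\<Delta> x)
      = sweedler (\<lambda>a b. T (\<Phi> a) (S (\<Phi> b))) x" for x
    by (intro tensor_lift_comult[OF vector_space_axioms] lin_twisted)
  then show ?thesis by (simp add: is_S_rhd_def antipode_rhd_Phi)
qed

lemma hopf_algebra_range_Phi:
  assumes R: "\<And>x. x \<in> range \<Phi> \<Longrightarrow> R x = antipode_rhd x"
  shows "cocommutative_hopf_algebra_on scale (range \<Phi>) circ \<one> comult counit R"
proof -
  let ?A = "range \<Phi>"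
  interpret A: cocommutative_bialgebra_on scale ?A circ \<one> comult counit
    by (rule bialgebra_range_Phi)
  show ?thesis
  proof unfold_locales
    show "R x \<in> ?A" if "x \<in> ?A" for x
      using that R[OF that] Phi_antipode_rhd[of x] by (simp add: range_Phi_iff)
    have "lin scale antipode_rhd" using lin_antipode_rhd[OF lin_ident] by simp
    then show "linear_on scale scale ?A R"
      using subspace_add[OF subspace_range_Phi] subspace_scale[OF subspace_range_Phi]
      by (simp add: linear_on_def R)
    show "tensor_lift scale ?A (\<lambda>a b. R a \<odot> b) (\<Delta> x) = \<epsilon> x *s \<one>" if x: "x \<in> ?A" for x
    proof -
      have "tensor_lift scale ?A (\<lambda>a b. R a \<odot> b) (\<Delta> x) = sweedler (\<lambda>a b. antipode_rhd a \<odot> b) (\<Phi> x)"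
        using x by (subst tensor_lift_range_Phi[OF vector_space_axioms,
              where F = "\<lambda>a b. antipode_rhd a \<odot> b"])
          (auto simp: R range_Phi_iff intro!: lin_twisted lin_antipode_rhd)
      also have "\<dots> = sweedler (\<lambda>a b. antipode_rhd (\<Phi> a) \<odot> \<Phi> b) x"
        by (intro sweedler_Phi[OF vector_space_axioms] lin_twisted lin_antipode_rhd)
      finally show ?thesis by (simp add: antipode_rhd_circ)
    qed
    show "tensor_lift scale ?A (\<lambda>a b. a \<odot> R b) (\<Delta> x) = \<epsilon> x *s \<one>" if x: "x \<in> ?A" for x
    proof -
      have "tensor_lift scale ?A (\<lambda>a b. a \<odot> R b) (\<Delta> x) = sweedler (\<lambda>a b. a \<odot> antipode_rhd b) (\<Phi> x)"
        using x by (subst tensor_lift_range_Phi[OF vector_space_axioms,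
              where F = "\<lambda>a b. a \<odot> antipode_rhd b"])
          (auto simp: R range_Phi_iff intro!: lin_twisted lin_antipode_rhd)
      also have "\<dots> = sweedler (\<lambda>a b. \<Phi> a \<odot> antipode_rhd (\<Phi> b)) x"
        by (intro sweedler_Phi[OF vector_space_axioms] lin_twisted lin_antipode_rhd)
      finally show ?thesis by (simp add: Phi_circ circ_antipode_rhd)
    qed
  qed
qed

end

theorem theorem6p10:
  fixes scale :: "'k::field_char_0 \<Rightarrow> 'h::ab_group_add \<Rightarrow> 'h"
    and mult rhd :: "'h \<Rightarrow> 'h \<Rightarrow> 'h"
    and one :: 'h
    and \<Delta> :: "'h \<Rightarrow> ('h, 'h, 'k) tensor"
    and \<epsilon> :: "'h \<Rightarrow> 'k"
    and S \<Phi> :: "'h \<Rightarrow> 'h"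
  assumes "twisted_post_hopf_algebra scale mult one \<Delta> \<epsilon> S rhd \<Phi>"
  shows "cocommutative_bialgebra_on scale (range \<Phi>) (sub_adjacent scale mult \<Delta> rhd \<Phi>) one \<Delta> \<epsilon> \<and>
    (\<exists>Srhd. is_S_rhd scale \<Delta> \<epsilon> S rhd \<Phi> Srhd) \<and>
    (\<forall>Srhd. is_S_rhd scale \<Delta> \<epsilon> S rhd \<Phi> Srhd \<longrightarrow>
       cocommutative_hopf_algebra_on scale (range \<Phi>) (sub_adjacent scale mult \<Delta> rhd \<Phi>) one \<Delta> \<epsilon> Srhd)"
proof -
  interpret twisted_post_hopf_algebra scale mult one \<Delta> \<epsilon> S rhd \<Phi> by fact
  show ?thesis
    using bialgebra_range_Phi hopf_algebra_range_Phi by (auto simp: is_S_rhd_iff)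
qed

end
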